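(* Let $S\subset\mathbb{R}^d$ be a bounded set, $M\in\mathbb{S}^{n\times n}_{++}$, and $A(\sigma)=A_0+\sum_{m=1}^d\sigma_mA_m$ for $\sigma\in\mathbb{C}^d$, with $A_0,\dots,A_d\in\mathbb{S}^{n\times n}$ and $A(\sigma)\in\mathbb{S}^{n\times n}_{++}$ for all $\sigma\in S$. Assume that $A:S\to\mathbb{S}^{n\times n}_{++}$ is spectrally equivalent to $\overline{A}\in\mathbb{S}^{n\times n}_{++}$ with constants $\alpha,\beta>0$. Let $\Lambda>0$ and let $\rho>1$ satisfy $\alpha\rho>1$. Let $D\subset\mathbb{C}^d$ be the set defined in the context. Then for every $t\in(0,\Lambda)$ the map $$\sigma\mapsto Z(\sigma,t)=W_\perp\big(A_\perp(\sigma)-tM_\perp\big)^{-1}W_\perp^T\big(A(\sigma)-\overline{A}\big)\in\mathbb{C}^{n\times n}$$ is complex-analytic on $D$; that is, every $\sigma_0\in D$ has a neighbourhood in $\mathbb{C}^d$ on which this formula is well defined and is given by a convergent power series in $\sigma-\sigma_0$.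
   Context: $\mathbb{S}^{n\times n}$ denotes the real symmetric $n\times n$ matrices and $\mathbb{S}^{n\times n}_{++}$ the symmetric positive definite ones. Spectral equivalence with constants $\alpha,\beta>0$: $\alpha\,v^T\overline{A}v\le v^TA(\sigma)v\le\beta\,v^T\overline{A}v$ for all $v\in\mathbb{R}^n$ and $\sigma\in S$. $\overline{E}_{\le\rho\Lambda}$ is the span of all eigenvectors of $\overline{A}v=yMv$ with eigenvalue $y\in(0,\rho\Lambda)$; $\overline{E}_{\le\rho\Lambda}^\perp$ is its $\overline{A}$-orthogonal complement in $\mathbb{R}^n$, $m=\dim\overline{E}_{\le\rho\Lambda}^\perp$, and $W_\perp\in\mathbb{R}^{n\times m}$ is a matrix whose columns form a basis of $\overline{E}_{\le\rho\Lambda}^\perp$. For any $n\times n$ matrix $B$, $B_\perp:=W_\perp^TBW_\perp$; in particular $A_\perp(\sigma)=W_\perp^TA(\sigma)W_\perp$. Each $\sigma\in\mathbb{C}^d$ is decomposed as $\sigma=\sigma_S+\sigma_P$, where $\sigma_S\in S$ is a closest point to $\sigma$ in $S$ (assumed to exist). Set $\delta A_\perp(\sigma_P):=A_\perp(\sigma_P)-A_{0\perp}=\sum_{i=1}^d(\sigma_P)_iA_{i\perp}$ and $$D:=\Big\{\sigma\in\mathbb{C}^d:\ \max_{0\ne x\in\mathbb{C}^m}\frac{|x^*\delta A_\perp(\sigma_P)x|}{x^*M_\perp x}<(\alpha\rho-1)\Lambda\Big\}.$$ *)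

theory Defs
  imports
    "HOL-Analysis.Analysis"
    "Jordan_Normal_Form.Matrix"
    "Jordan_Normal_Form.VS_Connect"
    "Jordan_Normal_Form.Gauss_Jordan_Elimination"
begin

text \<open>
  Matrices and the vectors they act on are those of \<open>Jordan_Normal_Form\<close>, with dimensions that
  are natural numbers. In particular the dimension \<open>m\<close> of the orthogonal complement, which depends
  on the data, may be \<open>0\<close>. The parameter spaces are \<open>real ^ 'd\<close> and \<open>complex ^ 'd\<close>
  with their Euclidean metric.
\<close>

no_notation vec_nth (infixl \<open>$\<close> 90)
no_notation inner (infixl \<open>\<bullet>\<close> 70)

abbreviation cmat :: "real mat \<Rightarrow> complex mat" where
  "cmat \<equiv> map_mat complex_of_real"

definition cpoint :: "real ^ 'd \<Rightarrow> complex ^ 'd" where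
  "cpoint s = (\<chi> l. complex_of_real (vec_nth s l))"

definition sym_mats :: "nat \<Rightarrow> real mat set" where
  "sym_mats n = {A \<in> carrier_mat n n. A\<^sup>T = A}"

definition spd_mats :: "nat \<Rightarrow> real mat set" where
  "spd_mats n = {A \<in> sym_mats n. \<forall>v \<in> carrier_vec n. v \<noteq> 0\<^sub>v n \<longrightarrow> v \<bullet> (A *\<^sub>v v) > 0}"

text \<open>
  \<open>A(\<sigma>) = A\<^sub>0 + \<Sum>\<^sub>l \<sigma>\<^sub>l A\<^sub>l\<close>, written entrywise because matrices of a fixed size are not a type
  that \<open>sum\<close> applies to.
\<close>

definition affine_mat ::
  "nat \<Rightarrow> 'a mat \<Rightarrow> ('d \<Rightarrow> 'a mat) \<Rightarrow> 'a ^ 'd \<Rightarrow> ('a :: comm_ring_1) mat" where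
  "affine_mat n A0 A \<sigma> =
     Matrix.mat n n (\<lambda>(i, j). A0 $$ (i, j) + (\<Sum>l\<in>UNIV. vec_nth \<sigma> l * A l $$ (i, j)))"

abbreviation caffine_mat ::
  "nat \<Rightarrow> real mat \<Rightarrow> ('d \<Rightarrow> real mat) \<Rightarrow> complex ^ 'd \<Rightarrow> complex mat" where
  "caffine_mat n A0 A \<equiv> affine_mat n (cmat A0) (\<lambda>l. cmat (A l))"

definition spectrally_equivalent ::
  "nat \<Rightarrow> 'p set \<Rightarrow> ('p \<Rightarrow> real mat) \<Rightarrow> real mat \<Rightarrow> real \<Rightarrow> real \<Rightarrow> bool" where
  "spectrally_equivalent n S A Abar \<alpha> \<beta> \<longleftrightarrow>
     (\<forall>v \<in> carrier_vec n. \<forall>\<sigma> \<in> S.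
        \<alpha> * (v \<bullet> (Abar *\<^sub>v v)) \<le> v \<bullet> (A \<sigma> *\<^sub>v v) \<and>
        v \<bullet> (A \<sigma> *\<^sub>v v) \<le> \<beta> * (v \<bullet> (Abar *\<^sub>v v)))"

definition low_eigenspace :: "nat \<Rightarrow> real mat \<Rightarrow> real mat \<Rightarrow> real \<Rightarrow> real vec set" where
  "low_eigenspace n Abar M c =
     LinearCombinations.module.span class_ring (module_vec TYPE(real) n)
       {v \<in> carrier_vec n. v \<noteq> 0\<^sub>v n \<and> (\<exists>y. 0 < y \<and> y < c \<and> Abar *\<^sub>v v = y \<cdot>\<^sub>v (M *\<^sub>v v))}"

definition orth_compl_wrt :: "nat \<Rightarrow> real mat \<Rightarrow> real vec set \<Rightarrow> real vec set" where
  "orth_compl_wrt n B U = {v \<in> carrier_vec n. \<forall>u \<in> U. u \<bullet> (B *\<^sub>v v) = 0}"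

abbreviation subspace_of :: "nat \<Rightarrow> real vec set \<Rightarrow> (real, real vec) module" where
  "subspace_of n U \<equiv> (module_vec TYPE(real) n)\<lparr>carrier := U\<rparr>"

definition columns_basis :: "nat \<Rightarrow> real mat \<Rightarrow> real vec set \<Rightarrow> bool" where
  "columns_basis n W U \<longleftrightarrow>
     distinct (cols W) \<and> vectorspace.basis class_ring (subspace_of n U) (set (cols W))"

definition compress :: "'a mat \<Rightarrow> 'a mat \<Rightarrow> ('a :: comm_ring_1) mat" where
  "compress W B = W\<^sup>T * B * W"

definition is_closest :: "(real ^ 'd) set \<Rightarrow> complex ^ 'd \<Rightarrow> real ^ 'd \<Rightarrow> bool" where
  "is_closest S \<sigma> s \<longleftrightarrow>
     s \<in> S \<and> (\<forall>s' \<in> S. dist \<sigma> (cpoint s) \<le> dist \<sigma> (cpoint s'))"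

definition delta_perp ::
  "nat \<Rightarrow> real mat \<Rightarrow> ('d \<Rightarrow> real mat) \<Rightarrow> real mat \<Rightarrow> complex ^ 'd \<Rightarrow> complex mat" where
  "delta_perp n A0 A W \<sigma>P = compress (cmat W) (caffine_mat n A0 A \<sigma>P) - compress (cmat W) (cmat A0)"

text \<open>
  Here \<open>x\<^sup>* B x\<close> is \<open>(B *\<^sub>v x) \<bullet>c x\<close>, the second factor being conjugated; \<open>x\<^sup>* M\<^sub>\<bottom> x\<close> is real and the
  quotient is homogeneous of degree \<open>0\<close>, so the supremum is the maximum over \<open>x \<noteq> 0\<close>
  whenever \<open>m > 0\<close>. For \<open>m = 0\<close> the supremum over the empty set is \<open>-\<infinity>\<close> in \<open>ereal\<close> and the set is
  everything. The map \<open>\<pi>\<close> sends \<open>\<sigma>\<close> to the chosen closest point \<open>\<sigma>\<^sub>S\<close>.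
\<close>

definition analyticity_domain ::
  "nat \<Rightarrow> nat \<Rightarrow> real mat \<Rightarrow> ('d \<Rightarrow> real mat) \<Rightarrow> real mat \<Rightarrow> real mat \<Rightarrow>
   (complex ^ 'd \<Rightarrow> real ^ 'd) \<Rightarrow> real \<Rightarrow> (complex ^ 'd) set" where
  "analyticity_domain n m A0 A M W \<pi> c =
     {\<sigma>. (SUP x \<in> {x \<in> carrier_vec m. x \<noteq> 0\<^sub>v m}.
            ereal (cmod ((delta_perp n A0 A W (\<sigma> - cpoint (\<pi> \<sigma>)) *\<^sub>v x) \<bullet>c x)
                   / Re ((compress (cmat W) (cmat M) *\<^sub>v x) \<bullet>c x))) < ereal c}"

definition shifted_perp ::
  "nat \<Rightarrow> real mat \<Rightarrow> ('d \<Rightarrow> real mat) \<Rightarrow> real mat \<Rightarrow> real mat \<Rightarrow> complex ^ 'd \<Rightarrow> real \<Rightarrow> complex mat" where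
  "shifted_perp n A0 A M W \<sigma> t =
     compress (cmat W) (caffine_mat n A0 A \<sigma>) - complex_of_real t \<cdot>\<^sub>m compress (cmat W) (cmat M)"

text \<open>\<open>Z\<close> is only meaningful where \<open>shifted_perp\<close> is invertible.\<close>

definition Z_mat ::
  "nat \<Rightarrow> real mat \<Rightarrow> ('d \<Rightarrow> real mat) \<Rightarrow> real mat \<Rightarrow> real mat \<Rightarrow> real mat \<Rightarrow>
   complex ^ 'd \<Rightarrow> real \<Rightarrow> complex mat" where
  "Z_mat n A0 A Abar M W \<sigma> t =
     cmat W * the (mat_inverse (shifted_perp n A0 A M W \<sigma> t)) * (cmat W)\<^sup>T
       * (caffine_mat n A0 A \<sigma> - cmat Abar)"

text \<open>
  Multi-indices are functions \<open>k :: 'd \<Rightarrow> nat\<close>, the coefficients \<open>C k\<close> are matrices, and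
  convergence is entrywise and unconditional, hence absolute.
\<close>

definition power_series_at ::
  "nat \<Rightarrow> (complex ^ 'd \<Rightarrow> complex mat) \<Rightarrow> (('d \<Rightarrow> nat) \<Rightarrow> complex mat) \<Rightarrow>
   complex ^ 'd \<Rightarrow> complex ^ 'd \<Rightarrow> bool" where
  "power_series_at n F C \<sigma>0 \<sigma> \<longleftrightarrow>
     (\<forall>i < n. \<forall>j < n.
        ((\<lambda>k. C k $$ (i, j) * (\<Prod>l\<in>UNIV. (vec_nth \<sigma> l - vec_nth \<sigma>0 l) ^ k l))
           has_sum F \<sigma> $$ (i, j)) UNIV)"

end

theory Submission
  imports Defs "Jordan_Normal_Form.DL_Rank"
begin

text \<open>
  On the complement of the low eigenspace, \<open>v\<^sup>T Abar v \<ge> \<rho> \<Lambda> v\<^sup>T M v\<close>, so spectral equivalence gives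
  \<open>x\<^sup>* A\<^sub>\<bottom>(\<sigma>\<^sub>S) x \<ge> \<alpha> \<rho> \<Lambda> x\<^sup>* M\<^sub>\<bottom> x\<close>. For \<open>\<sigma> \<in> D\<close> the perturbation \<open>\<delta>A\<^sub>\<bottom>(\<sigma>\<^sub>P)\<close> lowers the real part of this
  form by less than \<open>(\<alpha> \<rho> - 1) \<Lambda> x\<^sup>* M\<^sub>\<bottom> x\<close>, hence \<open>A\<^sub>\<bottom>(\<sigma>) - t M\<^sub>\<bottom>\<close> has trivial kernel for \<open>t < \<Lambda>\<close>.
  This matrix is affine in \<open>\<sigma>\<close>, so its inverse near a point of \<open>D\<close> is a Neumann series. Expanding
  that series gives one term for each word over the index type of the parameters; a multi-index
  collects the finitely many words with the same letter counts.
\<close>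

section \<open>Series indexed by words and the Neumann series of an affine pencil\<close>

text \<open>Expanding the power picks one letter from each factor, so words take the place of
  multinomial coefficients.\<close>

lemma sum_prod_list_fixed_length:
  fixes q :: "'d :: finite \<Rightarrow> 'a :: comm_semiring_1"
  shows "(\<Sum>w | length w = p. prod_list (map q w)) = (\<Sum>l\<in>UNIV. q l) ^ p"
proof (induction p)
  case 0
  have "{w :: 'd list. length w = 0} = {[]}" by auto
  then show ?case by simp
next
  case (Suc p)
  have split: "{w :: 'd list. length w = Suc p} = (\<lambda>(l, w). l # w) ` (UNIV \<times> {w. length w = p})"
    by (auto simp: length_Suc_conv image_iff)
  have inj: "inj_on (\<lambda>(l, w :: 'd list). l # w) (UNIV \<times> {w. length w = p})"
    by (auto simp: inj_on_def)
  have "(\<Sum>w | length w = Suc p. prod_list (map q w))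
      = (\<Sum>(l, w)\<in>UNIV \<times> {w. length w = p}. q l * prod_list (map q w))"
    unfolding split sum.reindex[OF inj] by (simp add: o_def case_prod_unfold)
  also have "\<dots> = (\<Sum>l\<in>UNIV. q l) * (\<Sum>w | length w = p. prod_list (map q w))"
    by (simp add: sum_product sum.cartesian_product)
  finally show ?case by (simp add: Suc.IH)
qed

lemma finite_words_of_length: "finite {w :: 'd :: finite list. length w = p}"
  using finite_lists_length_eq[of "UNIV :: 'd set" p] by simp

text \<open>Grouping words by length gives a geometric series whose ratio is the sum of the letter
  weights. As all terms are nonnegative, a bound on finite partial sums suffices.\<close>

lemma summable_on_words:
  fixes q :: "'d :: finite \<Rightarrow> real"
  assumes "\<And>l. q l \<ge> 0" and "(\<Sum>l\<in>UNIV. q l) < 1"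
  shows "(\<lambda>w. prod_list (map q w)) summable_on UNIV"
proof (rule nonneg_bdd_above_summable_on)
  have nonneg: "prod_list (map q w) \<ge> 0" for w
    by (induction w) (auto simp: assms)
  then show "prod_list (map q w) \<ge> 0" for w .
  define Q where "Q = (\<Sum>l\<in>UNIV. q l)"
  have Q: "Q \<ge> 0" "Q < 1"
    using assms by (auto simp: Q_def sum_nonneg)
  show "bdd_above (sum (\<lambda>w. prod_list (map q w)) ` {F. F \<subseteq> UNIV \<and> finite F})"
  proof (rule bdd_aboveI2)
    fix F :: "'d list set"
    assume "F \<in> {F. F \<subseteq> UNIV \<and> finite F}"
    then have F: "finite F" by simp
    \<comment> \<open>\<open>P\<close> exceeds every length occurring in \<open>F\<close>;
      \<open>insert 0\<close> keeps \<open>Max\<close> meaningful for empty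
      \<open>F\<close>.\<close>
    define P where "P = Suc (Max (insert 0 (length ` F)))"
    have sub: "F \<subseteq> (\<Union>p<P. {w. length w = p})"
      using F by (auto simp: P_def less_Suc_eq_le)
    have "(\<Sum>w\<in>F. prod_list (map q w)) \<le> (\<Sum>w\<in>(\<Union>p<P. {w. length w = p}). prod_list (map q w))"
      by (rule sum_mono2) (use sub nonneg finite_words_of_length in auto)
    also have "\<dots> = (\<Sum>p<P. \<Sum>w | length w = p. prod_list (map q w))"
      by (rule sum.UNION_disjoint) (auto simp: finite_words_of_length)
    also have "\<dots> = (\<Sum>p<P. Q ^ p)"
      by (simp add: sum_prod_list_fixed_length Q_def)
    also have "\<dots> \<le> 1 / (1 - Q)"
      using Q sum_le_suminf[of "\<lambda>p. Q ^ p" "{..<P}"] suminf_geometric[of Q] by simp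
    finally show "(\<Sum>w\<in>F. prod_list (map q w)) \<le> 1 / (1 - Q)" .
  qed
qed

lemma has_sum_finite_sum:
  fixes f :: "'i \<Rightarrow> 'a \<Rightarrow> 'b :: topological_comm_monoid_add"
  assumes "\<And>i. i \<in> I \<Longrightarrow> (f i has_sum s i) A"
  shows "((\<lambda>x. \<Sum>i\<in>I. f i x) has_sum (\<Sum>i\<in>I. s i)) A"
  using assms by (induction I rule: infinite_finite_induct) (auto intro: has_sum_add)

text \<open>A word is empty or has a unique first letter, so the words split into finitely many
  disjoint families. This recursion later becomes the fixed point equation of the Neumann
  series.\<close>

lemma has_sum_words_Cons:
  fixes f :: "'d :: finite list \<Rightarrow> 'a :: topological_comm_monoid_add"
  assumes "\<And>l. ((\<lambda>w. f (l # w)) has_sum s l) UNIV"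
  shows "(f has_sum (f [] + (\<Sum>l\<in>UNIV. s l))) UNIV"
proof -
  have "(f has_sum s l) (range ((#) l))" for l
    using assms[of l] by (subst has_sum_reindex) (auto simp: o_def)
  then have "(f has_sum (\<Sum>l\<in>UNIV. s l)) (\<Union>l\<in>UNIV. range ((#) l))"
    by (intro sum_has_sum) auto
  then have "(f has_sum (f [] + (\<Sum>l\<in>UNIV. s l))) ({[]} \<union> (\<Union>l\<in>UNIV. range ((#) l)))"
    by (intro has_sum_Un_disjoint) (auto intro: has_sum_finiteI)
  also have "{[]} \<union> (\<Union>l\<in>UNIV. range ((#) l)) = (UNIV :: 'd list set)"
  proof (rule UNIV_eq_I[symmetric])
    show "w \<in> {[]} \<union> (\<Union>l\<in>UNIV. range ((#) l))" for w :: "'d list"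
      by (cases w) auto
  qed
  finally show ?thesis .
qed

lemma prod_list_map_count_list:
  fixes h :: "'d :: finite \<Rightarrow> 'a :: comm_monoid_mult"
  shows "prod_list (map h w) = (\<Prod>l\<in>UNIV. h l ^ count_list w l)"
proof (induction w)
  case (Cons a w)
  have "(\<Prod>l\<in>UNIV. h l ^ count_list (a # w) l) = (\<Prod>l\<in>UNIV. (if l = a then h l else 1) * h l ^ count_list w l)"
    by (rule prod.cong) auto
  also have "\<dots> = h a * (\<Prod>l\<in>UNIV. h l ^ count_list w l)"
    by (simp add: prod.distrib prod.delta)
  finally show ?case using Cons.IH by simp
qed simp

text \<open>The letter counts determine the length, and a finite alphabet has finitely many words of
  each length.\<close>

lemma finite_words_of_count:
  fixes k :: "'d :: finite \<Rightarrow> nat"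
  shows "finite {w. count_list w = k}"
proof (rule finite_subset[OF _ finite_words_of_length])
  show "{w. count_list w = k} \<subseteq> {w. length w = (\<Sum>l\<in>UNIV. k l)}"
  proof clarify
    fix w :: "'d list"
    have "sum (count_list w) (set w) = sum (count_list w) UNIV"
      by (rule sum.mono_neutral_left) (auto simp: count_list_0_iff)
    then show "length w = sum (count_list w) UNIV"
      by (simp add: sum_count_set)
  qed
qed

text \<open>Passes from words to multi-indices: each word is paired with its letter counts, and the
  series over the pairs is summed first along the finite fibres.\<close>

lemma has_sum_group_by_count:
  fixes f :: "'d :: finite list \<Rightarrow> 'a :: banach"
  assumes "(f has_sum s) UNIV"
  shows "((\<lambda>k. \<Sum>w | count_list w = k. f w) has_sum s) UNIV"
proof -
  define S where "S = Sigma UNIV (\<lambda>k :: 'd \<Rightarrow> nat. {w. count_list w = k})"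
  have bij: "bij_betw snd S UNIV"
    by (rule bij_betwI[of _ _ _ "\<lambda>w. (count_list w, w)"]) (auto simp: S_def)
  have "((\<lambda>p. f (snd p)) has_sum s) S"
    using assms has_sum_reindex_bij_betw[OF bij, of f] by simp
  then show ?thesis
    unfolding S_def
    by (rule has_sum_SigmaD) (simp add: finite_words_of_count)
qed

section \<open>Functions with a word expansion on a ball\<close>

text \<open>Monomials are indexed by words instead of multi-indices, since the Neumann series has
  one term per word and multiplication by a coordinate just prepends a letter. The coefficients are
  redundant, as permuted words give the same monomial.\<close>

definition analytic_near :: "complex ^ 'd \<Rightarrow> real \<Rightarrow> (complex ^ 'd \<Rightarrow> complex) \<Rightarrow> bool" where
  "analytic_near z r f \<longleftrightarrow> (\<exists>c. \<forall>\<sigma> \<in> ball z r.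
     ((\<lambda>w. c w * prod_list (map (vec_nth (\<sigma> - z)) w)) has_sum f \<sigma>) UNIV)"

lemma analytic_near_cong:
  assumes "\<And>\<sigma>. \<sigma> \<in> ball z r \<Longrightarrow> f \<sigma> = g \<sigma>"
  shows "analytic_near z r f \<longleftrightarrow> analytic_near z r g"
  using assms by (simp add: analytic_near_def)

lemma analytic_near_const_mult:
  assumes "analytic_near z r f"
  shows "analytic_near z r (\<lambda>\<sigma>. a * f \<sigma>)"
proof -
  from assms obtain c where c: "\<And>\<sigma>. \<sigma> \<in> ball z r \<Longrightarrow>
      ((\<lambda>w. c w * prod_list (map (vec_nth (\<sigma> - z)) w)) has_sum f \<sigma>) UNIV"
    unfolding analytic_near_def by blast
  show ?thesis
    unfolding analytic_near_def
    by (rule exI[of _ "\<lambda>w. a * c w"])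
      (use has_sum_cmult_right[OF c, of _ a] in \<open>simp add: mult.assoc\<close>)
qed

lemma analytic_near_sum:
  assumes "\<And>i. i \<in> I \<Longrightarrow> analytic_near z r (f i)"
  shows "analytic_near z r (\<lambda>\<sigma>. \<Sum>i\<in>I. f i \<sigma>)"
proof -
  from assms obtain c where c: "\<And>i \<sigma>. i \<in> I \<Longrightarrow> \<sigma> \<in> ball z r \<Longrightarrow>
      ((\<lambda>w. c i w * prod_list (map (vec_nth (\<sigma> - z)) w)) has_sum f i \<sigma>) UNIV"
    unfolding analytic_near_def by metis
  have "((\<lambda>w. (\<Sum>i\<in>I. c i w) * prod_list (map (vec_nth (\<sigma> - z)) w)) has_sum (\<Sum>i\<in>I. f i \<sigma>)) UNIV"
    if "\<sigma> \<in> ball z r" for \<sigma>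
    unfolding sum_distrib_right by (rule has_sum_finite_sum) (rule c[OF _ that])
  then show ?thesis
    unfolding analytic_near_def by (intro exI[of _ "\<lambda>w. \<Sum>i\<in>I. c i w"] ballI)
qed

lemma analytic_near_add:
  assumes "analytic_near z r f" "analytic_near z r g"
  shows "analytic_near z r (\<lambda>\<sigma>. f \<sigma> + g \<sigma>)"
  using analytic_near_sum[of "UNIV :: bool set" z r "\<lambda>b. if b then f else g"] assms
  by (simp add: UNIV_bool add.commute)

lemma analytic_near_mult_coordinate:
  assumes "analytic_near z r f"
  shows "analytic_near z r (\<lambda>\<sigma>. vec_nth (\<sigma> - z) l * f \<sigma>)"
proof -
  from assms obtain c where c: "\<And>\<sigma>. \<sigma> \<in> ball z r \<Longrightarrow>
      ((\<lambda>w. c w * prod_list (map (vec_nth (\<sigma> - z)) w)) has_sum f \<sigma>) UNIV"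
    unfolding analytic_near_def by blast
  \<comment> \<open>Multiplication by coordinate \<open>l\<close> shifts the coefficients: a word
    starting with \<open>l\<close> inherits that of its tail, every other word, the empty one
    included, gets 0.\<close>
  define c' where "c' w = (case w of [] \<Rightarrow> 0 | l' # w' \<Rightarrow> if l' = l then c w' else 0)" for w
  have "((\<lambda>w. c' w * prod_list (map (vec_nth (\<sigma> - z)) w)) has_sum vec_nth (\<sigma> - z) l * f \<sigma>) UNIV"
    if \<sigma>: "\<sigma> \<in> ball z r" for \<sigma>
  proof -
    let ?h = "vec_nth (\<sigma> - z)"
    have "((\<lambda>w. c' (l' # w) * prod_list (map ?h (l' # w)))
          has_sum (if l' = l then ?h l * f \<sigma> else 0)) UNIV" for l'
      using has_sum_cmult_right[OF c[OF \<sigma>], of "?h l"]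
      by (auto simp: c'_def mult_ac intro: has_sum_0)
    from has_sum_words_Cons[OF this]
    have "((\<lambda>w. c' w * prod_list (map ?h w)) has_sum
        (c' [] * prod_list (map ?h []) + (\<Sum>l'\<in>UNIV. if l' = l then ?h l * f \<sigma> else 0))) UNIV" .
    moreover have "c' [] * prod_list (map ?h []) + (\<Sum>l'\<in>UNIV. if l' = l then ?h l * f \<sigma> else 0)
        = ?h l * f \<sigma>"
      by (simp add: c'_def)
    ultimately show ?thesis by (simp only:)
  qed
  then show ?thesis unfolding analytic_near_def by blast
qed

text \<open>The monomial of a word depends only on its letter counts, so the coefficient of a
  multi-index is the finite sum over all words with these counts.\<close>

lemma analytic_near_imp_multiindex_series:
  assumes "analytic_near z r f"
  obtains C where "\<And>\<sigma>. \<sigma> \<in> ball z r \<Longrightarrow>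
    ((\<lambda>k. C k * (\<Prod>l\<in>UNIV. (vec_nth \<sigma> l - vec_nth z l) ^ k l)) has_sum f \<sigma>) UNIV"
proof -
  from assms obtain c where c: "\<And>\<sigma>. \<sigma> \<in> ball z r \<Longrightarrow>
      ((\<lambda>w. c w * prod_list (map (vec_nth (\<sigma> - z)) w)) has_sum f \<sigma>) UNIV"
    unfolding analytic_near_def by blast
  show thesis
  proof (rule that[of "\<lambda>k. \<Sum>w | count_list w = k. c w"])
    fix \<sigma>
    assume "\<sigma> \<in> ball z r"
    from has_sum_group_by_count[OF c[OF this]]
    show "((\<lambda>k. (\<Sum>w | count_list w = k. c w) * (\<Prod>l\<in>UNIV. (vec_nth \<sigma> l - vec_nth z l) ^ k l))
        has_sum f \<sigma>) UNIV"
      by (rule has_sum_cong[THEN iffD1, rotated])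
        (auto simp: sum_distrib_right prod_list_map_count_list intro!: sum.cong)
  qed
qed

section \<open>Neumann series and inverse of an affine pencil\<close>

text \<open>The coefficient of the word \<open>w\<close> in the Neumann series of
  \<open>(1 - H)^-1 R\<close>, where \<open>H\<close> is the sum of the \<open>X l\<close> weighted
  by the coordinates.\<close>

definition word_mat :: "complex mat \<Rightarrow> ('d \<Rightarrow> complex mat) \<Rightarrow> 'd list \<Rightarrow> complex mat" where
  "word_mat R X w = foldr (\<lambda>l Y. X l * Y) w R"

lemma word_mat_simps [simp]:
  "word_mat R X [] = R"
  "word_mat R X (l # w) = X l * word_mat R X w"
  by (simp_all add: word_mat_def)

lemma word_mat_carrier:
  assumes "R \<in> carrier_mat k k" "\<And>l. X l \<in> carrier_mat k k"
  shows "word_mat R X w \<in> carrier_mat k k"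
  by (induction w) (use assms in \<open>auto intro: mult_carrier_mat\<close>)

lemma mult_mat_entry:
  assumes "A \<in> carrier_mat a b" "B \<in> carrier_mat b c" "i < a" "j < c"
  shows "(A * B) $$ (i, j) = (\<Sum>p<b. A $$ (i, p) * B $$ (p, j))"
  using assms by (auto simp: scalar_prod_def atLeast0LessThan)

text \<open>Each further factor forms sums of \<open>k\<close> products with entries bounded by
  \<open>K\<close>, which costs a factor \<open>k * K\<close>. Left multiplication keeps the column,
  so the induction generalizes only the row.\<close>

lemma word_mat_entry_bound:
  assumes R: "R \<in> carrier_mat k k" and X: "\<And>l. X l \<in> carrier_mat k k"
    and KR: "\<And>i j. i < k \<Longrightarrow> j < k \<Longrightarrow> cmod (R $$ (i, j)) \<le> K"
    and KX: "\<And>l i j. i < k \<Longrightarrow> j < k \<Longrightarrow> cmod (X l $$ (i, j)) \<le> K"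
    and "i < k" "j < k"
  shows "cmod (word_mat R X w $$ (i, j)) \<le> K * (real k * K) ^ length w"
  using \<open>i < k\<close>
proof (induction w arbitrary: i)
  case Nil
  then show ?case using KR \<open>j < k\<close> by simp
next
  case (Cons l w)
  have K: "K \<ge> 0" using KR[OF \<open>i < k\<close> \<open>j < k\<close>] norm_ge_zero order_trans by blast
  have "cmod (word_mat R X (l # w) $$ (i, j))
      = cmod (\<Sum>p<k. X l $$ (i, p) * word_mat R X w $$ (p, j))"
    using mult_mat_entry[OF X word_mat_carrier[of R k X w, OF R X] \<open>i < k\<close> \<open>j < k\<close>, of l] by simp
  also have "\<dots> \<le> (\<Sum>p<k. cmod (X l $$ (i, p)) * cmod (word_mat R X w $$ (p, j)))"
    by (rule order_trans[OF norm_sum]) (simp add: norm_mult)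
  also have "\<dots> \<le> (\<Sum>p<k. K * (K * (real k * K) ^ length w))"
    by (intro sum_mono mult_mono KX Cons.IH) (use Cons.prems K in auto)
  also have "\<dots> = K * (real k * K) ^ length (l # w)"
    by simp
  finally show ?case .
qed

lemma finite_entry_bound:
  fixes Y :: "'i \<Rightarrow> complex mat"
  assumes "finite I"
  obtains K where "K \<ge> 0" "\<And>l i j. l \<in> I \<Longrightarrow> i < k \<Longrightarrow> j < k \<Longrightarrow> cmod (Y l $$ (i, j)) \<le> K"
proof
  \<comment> \<open>For \<open>k = 0\<close> this set is empty, hence the \<open>insert 0\<close>
    below.\<close>
  let ?E = "(\<lambda>(l, i, j). cmod (Y l $$ (i, j))) ` (I \<times> {..<k} \<times> {..<k})"
  show "Max (insert 0 ?E) \<ge> 0" using assms by simp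
  show "cmod (Y l $$ (i, j)) \<le> Max (insert 0 ?E)" if "l \<in> I" "i < k" "j < k" for l i j
    by (rule Max_ge) (use assms that in \<open>auto simp: image_iff\<close>)
qed

lemma affine_mat_carrier [simp]: "affine_mat n A0 A \<sigma> \<in> carrier_mat n n"
  by (simp add: affine_mat_def)

lemma affine_mat_entry:
  "i < n \<Longrightarrow> j < n \<Longrightarrow>
    affine_mat n A0 A \<sigma> $$ (i, j) = A0 $$ (i, j) + (\<Sum>l\<in>UNIV. vec_nth \<sigma> l * A l $$ (i, j))"
  by (simp add: affine_mat_def)

text \<open>\<open>G\<close> is the sum over all words, taken entry by entry; splitting off the
  first letter yields the equation \<open>G = R + H G\<close>.\<close>

lemma neumann_fixed_point:
  fixes X :: "'d :: finite \<Rightarrow> complex mat" and z :: "complex ^ 'd"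
  assumes R: "R \<in> carrier_mat k k" and X: "\<And>l. X l \<in> carrier_mat k k"
  obtains r G where "r > 0" "\<And>\<sigma>. G \<sigma> \<in> carrier_mat k k"
    "\<And>\<sigma>. \<sigma> \<in> ball z r \<Longrightarrow> G \<sigma> = R + affine_mat k (0\<^sub>m k k) X (\<sigma> - z) * G \<sigma>"
    "\<And>i j. i < k \<Longrightarrow> j < k \<Longrightarrow> analytic_near z r (\<lambda>\<sigma>. G \<sigma> $$ (i, j))"
proof -
  obtain K1 where K1: "K1 \<ge> 0" "\<And>i j. i < k \<Longrightarrow> j < k \<Longrightarrow> cmod (R $$ (i, j)) \<le> K1"
    using finite_entry_bound[of "{()}" k "\<lambda>_. R"] by auto
  obtain K2 where K2: "K2 \<ge> 0" "\<And>l i j. i < k \<Longrightarrow> j < k \<Longrightarrow> cmod (X l $$ (i, j)) \<le> K2"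
    using finite_entry_bound[of UNIV k X] by auto
  define K where "K = max K1 K2"
  have K: "K \<ge> 0" "\<And>i j. i < k \<Longrightarrow> j < k \<Longrightarrow> cmod (R $$ (i, j)) \<le> K"
    "\<And>l i j. i < k \<Longrightarrow> j < k \<Longrightarrow> cmod (X l $$ (i, j)) \<le> K"
    unfolding K_def using K1 K2 by (simp_all add: le_max_iff_disj)
  \<comment> \<open>Inside this radius the letter weights \<open>?q\<close> below sum to at most
    \<open>x / (1 + x) < 1\<close> with \<open>x = CARD('d) * k * K\<close>. The summand 1 also
    covers \<open>k * K = 0\<close>.\<close>
  define r where "r = 1 / (1 + real CARD('d) * (real k * K))"
  have r: "r > 0"
    unfolding r_def using K(1) by (intro divide_pos_pos add_pos_nonneg) auto
  define F where "F i j \<sigma> w = word_mat R X w $$ (i, j) * prod_list (map (vec_nth (\<sigma> - z)) w)"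
    for i j \<sigma> w
  define G where "G \<sigma> = Matrix.mat k k (\<lambda>(i, j). infsum (F i j \<sigma>) UNIV)" for \<sigma>
  have sums: "(F i j \<sigma> has_sum G \<sigma> $$ (i, j)) UNIV"
    if \<sigma>: "\<sigma> \<in> ball z r" and ij: "i < k" "j < k" for \<sigma> i j
  proof -
    \<comment> \<open>The factor \<open>k * K\<close> per letter absorbs the growth in
      \<open>word_mat_entry_bound\<close>, so the words weighted by \<open>?q\<close> majorize the
      series.\<close>
    let ?q = "\<lambda>l. real k * K * cmod (vec_nth (\<sigma> - z) l)"
    have "(\<Sum>l\<in>UNIV. ?q l) \<le> (\<Sum>l\<in>(UNIV :: 'd set). real k * K * r)"
    proof (intro sum_mono mult_left_mono)
      fix l
      have "cmod (vec_nth (\<sigma> - z) l) \<le> dist \<sigma> z"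
        unfolding dist_norm by (rule Finite_Cartesian_Product.norm_nth_le)
      then show "cmod (vec_nth (\<sigma> - z) l) \<le> r"
        using \<sigma> by (simp add: dist_commute)
    qed (use K in auto)
    also have "\<dots> < 1"
    proof -
      have "0 \<le> real CARD('d) * (real k * K)"
        using K(1) by auto
      then show ?thesis
        by (simp add: r_def divide_simps algebra_simps)
    qed
    finally have "(\<lambda>w. prod_list (map ?q w)) summable_on UNIV"
      by (intro summable_on_words) (use K in auto)
    then have "(\<lambda>w. K * prod_list (map ?q w)) summable_on UNIV"
      by (rule summable_on_cmult_right)
    then have "(\<lambda>w. norm (F i j \<sigma> w)) summable_on UNIV"
    proof (rule summable_on_comparison_test)
      fix w
      have q: "prod_list (map ?q w)
          = (real k * K) ^ length w * cmod (prod_list (map (vec_nth (\<sigma> - z)) w))"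
        by (induction w) (auto simp: norm_mult)
      have "norm (F i j \<sigma> w)
          \<le> K * (real k * K) ^ length w * cmod (prod_list (map (vec_nth (\<sigma> - z)) w))"
        unfolding F_def norm_mult
        by (intro mult_right_mono word_mat_entry_bound[OF R X K(2,3)] ij) auto
      then show "norm (F i j \<sigma> w) \<le> K * prod_list (map ?q w)"
        unfolding q by (simp add: mult.assoc)
    qed auto
    then have "F i j \<sigma> summable_on UNIV"
      by (rule abs_summable_summable)
    then show ?thesis using ij by (simp add: G_def)
  qed
  have G: "G \<sigma> \<in> carrier_mat k k" for \<sigma>
    by (simp add: G_def)
  have fp: "G \<sigma> = R + affine_mat k (0\<^sub>m k k) X (\<sigma> - z) * G \<sigma>" if \<sigma>: "\<sigma> \<in> ball z r" for \<sigma>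
  proof (rule eq_matI)
    fix i j
    assume "i < dim_row (R + affine_mat k (0\<^sub>m k k) X (\<sigma> - z) * G \<sigma>)"
      "j < dim_col (R + affine_mat k (0\<^sub>m k k) X (\<sigma> - z) * G \<sigma>)"
    then have ij: "i < k" "j < k" using G by (auto simp: affine_mat_def G_def)
    let ?h = "vec_nth (\<sigma> - z)"
    \<comment> \<open>The words starting with \<open>l\<close> contribute the \<open>l\<close>-th
      summand of \<open>H G\<close>; the empty word contributes \<open>R\<close>.\<close>
    have "((\<lambda>w. F i j \<sigma> (l # w)) has_sum (\<Sum>p<k. ?h l * X l $$ (i, p) * G \<sigma> $$ (p, j))) UNIV" for l
    proof -
      have "((\<lambda>w. \<Sum>p<k. ?h l * X l $$ (i, p) * F p j \<sigma> w)
          has_sum (\<Sum>p<k. ?h l * X l $$ (i, p) * G \<sigma> $$ (p, j))) UNIV"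
        by (intro has_sum_finite_sum has_sum_cmult_right sums \<sigma> ij) auto
      moreover have "F i j \<sigma> (l # w) = (\<Sum>p<k. ?h l * X l $$ (i, p) * F p j \<sigma> w)" for w
      proof -
        have "F i j \<sigma> (l # w) = (\<Sum>p<k. X l $$ (i, p) * word_mat R X w $$ (p, j)) * (?h l * prod_list (map ?h w))"
          unfolding F_def using mult_mat_entry[OF X word_mat_carrier[of R k X w, OF R X] ij, of l] by simp
        then show ?thesis
          unfolding F_def sum_distrib_right by (simp add: mult_ac)
      qed
      ultimately show ?thesis by simp
    qed
    from has_sum_words_Cons[OF this] sums[OF \<sigma> ij]
    have "G \<sigma> $$ (i, j) = F i j \<sigma> [] + (\<Sum>l\<in>UNIV. \<Sum>p<k. ?h l * X l $$ (i, p) * G \<sigma> $$ (p, j))"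
      using has_sum_unique by blast
    also have "\<dots> = R $$ (i, j) + (\<Sum>p<k. (\<Sum>l\<in>UNIV. ?h l * X l $$ (i, p)) * G \<sigma> $$ (p, j))"
      by (subst sum.swap) (simp add: F_def sum_distrib_right)
    also have "\<dots> = R $$ (i, j) + (affine_mat k (0\<^sub>m k k) X (\<sigma> - z) * G \<sigma>) $$ (i, j)"
      using ij by (simp add: mult_mat_entry[OF affine_mat_carrier G] affine_mat_entry)
    also have "\<dots> = (R + affine_mat k (0\<^sub>m k k) X (\<sigma> - z) * G \<sigma>) $$ (i, j)"
      using ij R G by (simp add: affine_mat_def G_def)
    finally show "G \<sigma> $$ (i, j) = (R + affine_mat k (0\<^sub>m k k) X (\<sigma> - z) * G \<sigma>) $$ (i, j)" .
  qed (use R in \<open>auto simp: affine_mat_def G_def\<close>)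
  have an: "analytic_near z r (\<lambda>\<sigma>. G \<sigma> $$ (i, j))" if "i < k" "j < k" for i j
    unfolding analytic_near_def
    by (rule exI[of _ "\<lambda>w. word_mat R X w $$ (i, j)"])
      (use sums[OF _ that] in \<open>unfold F_def, blast\<close>)
  show thesis by (rule that[OF r G fp an])
qed

text \<open>With \<open>H\<close> the part linear in the coordinates,
  \<open>N0 + H = N0 (1 + R H)\<close>, so the inverse is \<open>(1 + R H)^-1 R\<close>, the fixed
  point of \<open>G = R - R H G\<close>. This dictates \<open>X l = - (R * B l)\<close>.\<close>

lemma affine_pencil_inverse:
  fixes B :: "'d :: finite \<Rightarrow> complex mat" and z :: "complex ^ 'd"
  assumes N0: "N0 \<in> carrier_mat k k" and R: "R \<in> carrier_mat k k" and inv: "N0 * R = 1\<^sub>m k"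
    and B: "\<And>l. B l \<in> carrier_mat k k"
  obtains r G where "r > 0" "\<And>\<sigma>. G \<sigma> \<in> carrier_mat k k"
    "\<And>\<sigma>. \<sigma> \<in> ball z r \<Longrightarrow> affine_mat k N0 B (\<sigma> - z) * G \<sigma> = 1\<^sub>m k"
    "\<And>i j. i < k \<Longrightarrow> j < k \<Longrightarrow> analytic_near z r (\<lambda>\<sigma>. G \<sigma> $$ (i, j))"
proof -
  define X where "X l = - (R * B l)" for l
  have X: "X l \<in> carrier_mat k k" for l using R B by (simp add: X_def)
  obtain r G where r: "r > 0" and G: "\<And>\<sigma>. G \<sigma> \<in> carrier_mat k k"
    and fp: "\<And>\<sigma>. \<sigma> \<in> ball z r \<Longrightarrow> G \<sigma> = R + affine_mat k (0\<^sub>m k k) X (\<sigma> - z) * G \<sigma>"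
    and an: "\<And>i j. i < k \<Longrightarrow> j < k \<Longrightarrow> analytic_near z r (\<lambda>\<sigma>. G \<sigma> $$ (i, j))"
    using neumann_fixed_point[of R k X z, OF R X] by metis
  have right_inv: "affine_mat k N0 B (\<sigma> - z) * G \<sigma> = 1\<^sub>m k" if \<sigma>: "\<sigma> \<in> ball z r" for \<sigma>
  proof -
    define H where "H = affine_mat k (0\<^sub>m k k) B (\<sigma> - z)"
    have H: "H \<in> carrier_mat k k" by (simp add: H_def)
    have XH: "affine_mat k (0\<^sub>m k k) X (\<sigma> - z) = - (R * H)"
    proof (rule eq_matI)
      fix i j
      assume "i < dim_row (- (R * H))" "j < dim_col (- (R * H))"
      then have ij: "i < k" "j < k" using R H by auto
      have "affine_mat k (0\<^sub>m k k) X (\<sigma> - z) $$ (i, j)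
          = - (\<Sum>l\<in>UNIV. \<Sum>p<k. vec_nth (\<sigma> - z) l * (R $$ (i, p) * B l $$ (p, j)))"
      proof -
        have "X l $$ (i, j) = - (\<Sum>p<k. R $$ (i, p) * B l $$ (p, j))" for l
          using mult_mat_entry[OF R B ij, of l] R B[of l] ij by (simp add: X_def)
        then show ?thesis
          using ij by (simp add: affine_mat_entry sum_negf sum_distrib_left)
      qed
      also have "\<dots> = - (\<Sum>p<k. R $$ (i, p) * H $$ (p, j))"
        unfolding H_def using ij
        by (subst sum.swap) (simp add: affine_mat_entry sum_distrib_left mult_ac)
      also have "\<dots> = (- (R * H)) $$ (i, j)"
        using mult_mat_entry[OF R H ij] R H ij by simp
      finally show "affine_mat k (0\<^sub>m k k) X (\<sigma> - z) $$ (i, j) = (- (R * H)) $$ (i, j)" .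
    qed (use R H in \<open>auto simp: affine_mat_def\<close>)
    have split: "affine_mat k N0 B (\<sigma> - z) = N0 + H"
      by (rule eq_matI) (use N0 in \<open>auto simp: H_def affine_mat_def\<close>)
    have RHG: "R * (H * G \<sigma>) \<in> carrier_mat k k" "H * G \<sigma> \<in> carrier_mat k k" using R H G by auto
    have "G \<sigma> = R - R * (H * G \<sigma>)"
    proof -
      have "- (R * H) * G \<sigma> = - (R * (H * G \<sigma>))"
        using R H G[of \<sigma>] by (simp add: assoc_mult_mat[OF R H G] uminus_mult_left_mat[of "R * H" "G \<sigma>", symmetric])
      then show ?thesis
        using fp[OF \<sigma>] RHG R unfolding XH by (metis minus_add_uminus_mat)
    qed
    \<comment> \<open>Multiplying the fixed point equation by \<open>N0\<close> cancels
      \<open>R\<close> in both terms and leaves \<open>N0 G = 1 - H G\<close>.\<close>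
    then have "N0 * G \<sigma> = N0 * (R - R * (H * G \<sigma>))" by (rule arg_cong)
    also have "\<dots> = N0 * R - N0 * (R * (H * G \<sigma>))"
      by (rule mult_minus_distrib_mat[OF N0 R RHG(1)])
    also have "N0 * (R * (H * G \<sigma>)) = H * G \<sigma>"
      using assoc_mult_mat[OF N0 R RHG(2)] left_mult_one_mat[OF RHG(2)] by (simp only: inv)
    finally have N0G: "N0 * G \<sigma> = 1\<^sub>m k - H * G \<sigma>" unfolding inv .
    have "affine_mat k N0 B (\<sigma> - z) * G \<sigma> = N0 * G \<sigma> + H * G \<sigma>"
      unfolding split by (rule add_mult_distrib_mat[OF N0 H G])
    also have "\<dots> = 1\<^sub>m k"
    proof -
      have "1\<^sub>m k - Y + Y = 1\<^sub>m k" if "Y \<in> carrier_mat k k" for Y :: "complex mat"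
        by (rule eq_matI) (use that in auto)
      from this[OF RHG(2)] show ?thesis unfolding N0G .
    qed
    finally show ?thesis .
  qed
  show thesis
    by (rule that[of r G]) (fact r G right_inv an)+
qed

section \<open>Matrix products with analytic entries\<close>

lemma analytic_near_const_mat_mult:
  assumes K: "K \<in> carrier_mat a b" and F: "\<And>\<sigma>. F \<sigma> \<in> carrier_mat b c"
    and an: "\<And>i j. i < b \<Longrightarrow> j < c \<Longrightarrow> analytic_near z r (\<lambda>\<sigma>. F \<sigma> $$ (i, j))"
    and ij: "i < a" "j < c"
  shows "analytic_near z r (\<lambda>\<sigma>. (K * F \<sigma>) $$ (i, j))"
  unfolding mult_mat_entry[OF K F ij]
  by (intro analytic_near_sum analytic_near_const_mult an) (use ij in auto)

lemma analytic_near_mult_const_mat: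
  assumes K: "K \<in> carrier_mat b c" and F: "\<And>\<sigma>. F \<sigma> \<in> carrier_mat a b"
    and an: "\<And>i j. i < a \<Longrightarrow> j < b \<Longrightarrow> analytic_near z r (\<lambda>\<sigma>. F \<sigma> $$ (i, j))"
    and ij: "i < a" "j < c"
  shows "analytic_near z r (\<lambda>\<sigma>. (F \<sigma> * K) $$ (i, j))"
  unfolding mult_mat_entry[OF F K ij] mult.commute[of _ "K $$ _"]
  by (intro analytic_near_sum analytic_near_const_mult an) (use ij in auto)

text \<open>The right factor has degree at most one in the coordinates, so constant multiples and
  coordinate multiples suffice and no product of two series arises.\<close>

lemma analytic_near_mult_affine_mat:
  fixes B :: "'d :: finite \<Rightarrow> complex mat"
  assumes F: "\<And>\<sigma>. F \<sigma> \<in> carrier_mat a n"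
    and an: "\<And>i j. i < a \<Longrightarrow> j < n \<Longrightarrow> analytic_near z r (\<lambda>\<sigma>. F \<sigma> $$ (i, j))"
    and ij: "i < a" "j < n"
  shows "analytic_near z r (\<lambda>\<sigma>. (F \<sigma> * affine_mat n N B (\<sigma> - z)) $$ (i, j))"
proof -
  have "(F \<sigma> * affine_mat n N B (\<sigma> - z)) $$ (i, j)
      = (\<Sum>p<n. N $$ (p, j) * F \<sigma> $$ (i, p)
          + (\<Sum>l\<in>UNIV. B l $$ (p, j) * (vec_nth (\<sigma> - z) l * F \<sigma> $$ (i, p))))" for \<sigma>
    unfolding mult_mat_entry[OF F affine_mat_carrier ij]
    using ij by (intro sum.cong refl) (simp add: affine_mat_entry sum_distrib_left algebra_simps)
  moreover have "analytic_near z r (\<lambda>\<sigma>. \<Sum>p<n. N $$ (p, j) * F \<sigma> $$ (i, p)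
          + (\<Sum>l\<in>UNIV. B l $$ (p, j) * (vec_nth (\<sigma> - z) l * F \<sigma> $$ (i, p))))"
    by (intro analytic_near_sum analytic_near_add analytic_near_const_mult
        analytic_near_mult_coordinate an) (use ij in auto)
  ultimately show ?thesis by simp
qed

text \<open>All entries converge on the same ball, so their coefficients can be chosen separately
  and assembled into one matrix per multi-index.\<close>

lemma power_series_at_if_entries_analytic:
  assumes "\<And>i j. i < n \<Longrightarrow> j < n \<Longrightarrow> analytic_near z r (\<lambda>\<sigma>. F \<sigma> $$ (i, j))"
  obtains C where "\<And>k. C k \<in> carrier_mat n n" "\<And>\<sigma>. \<sigma> \<in> ball z r \<Longrightarrow> power_series_at n F C z \<sigma>"
proof -
  define is_series where "is_series i j c \<longleftrightarrow> (\<forall>\<sigma> \<in> ball z r.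
      ((\<lambda>k. c k * (\<Prod>l\<in>UNIV. (vec_nth \<sigma> l - vec_nth z l) ^ k l)) has_sum F \<sigma> $$ (i, j)) UNIV)"
    for i j c
  define c where "c i j = (SOME c. is_series i j c)" for i j
  have c: "is_series i j (c i j)" if ij: "i < n" "j < n" for i j
  proof -
    have "\<exists>C. is_series i j C"
      unfolding is_series_def
      by (rule analytic_near_imp_multiindex_series[OF assms[OF ij]]) blast
    then show ?thesis unfolding c_def by (rule someI_ex)
  qed
  show thesis
    by (rule that[of "\<lambda>k. Matrix.mat n n (\<lambda>(i, j). c i j k)"])
      (use c in \<open>simp_all add: power_series_at_def is_series_def\<close>)
qed

section \<open>The Rayleigh quotient on the complement of the low eigenspace\<close>

lemma orth_compl_wrt_iff:
  "v \<in> orth_compl_wrt n B U \<longleftrightarrow> v \<in> carrier_vec n \<and> (\<forall>u \<in> U. u \<bullet> (B *\<^sub>v v) = 0)"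
  by (simp add: orth_compl_wrt_def)

lemma scalar_prod_span_eq_0:
  fixes x :: "real vec"
  assumes G: "G \<subseteq> carrier_vec n" and x: "x \<in> carrier_vec n"
    and 0: "\<And>g. g \<in> G \<Longrightarrow> g \<bullet> x = 0"
    and u: "u \<in> LinearCombinations.module.span class_ring (module_vec TYPE(real) n) G"
  shows "u \<bullet> x = 0"
proof -
  interpret vec_space "TYPE(real)" n .
  from u obtain a F where F: "finite F" "F \<subseteq> G" and u: "u = lincomb a F"
    unfolding span_def by auto
  have "u \<bullet> x = (\<Sum>g\<in>F. (a g \<cdot>\<^sub>v g) \<bullet> x)"
    unfolding u lincomb_def by (rule finsum_scalar_prod_sum) (use F G x in auto)
  also have "\<dots> = 0"
  proof (rule sum.neutral, rule ballI)
    fix g assume "g \<in> F"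
    then have "g \<in> G" using F by auto
    then show "(a g \<cdot>\<^sub>v g) \<bullet> x = 0" using 0 G x by (auto simp: smult_scalar_prod_distrib[of _ n])
  qed
  finally show ?thesis .
qed

lemma generalized_eigenvector_in_low_eigenspace:
  assumes "v \<in> carrier_vec n" "v \<noteq> 0\<^sub>v n" "0 < y" "y < c" "B *\<^sub>v v = y \<cdot>\<^sub>v (M *\<^sub>v v)"
  shows "v \<in> low_eigenspace n B M c"
proof -
  interpret vec_space "TYPE(real)" n .
  show ?thesis
    unfolding low_eigenspace_def
    by (rule subsetD[OF in_own_span]) (use assms in auto)
qed

lemma low_eigenspace_carrier: "low_eigenspace n B M c \<subseteq> carrier_vec n"
proof -
  interpret vec_space "TYPE(real)" n .
  show ?thesis unfolding low_eigenspace_def by (rule span_is_subset2) auto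
qed

text \<open>A basis in \<open>columns_basis\<close> is one of the complement as a vector space in
  its own right; the submodule property lets linear independence pass to the ambient space.\<close>

lemma orth_compl_wrt_submodule:
  assumes B: "B \<in> carrier_mat n n" and U: "U \<subseteq> carrier_vec n"
  shows "submodule class_ring (orth_compl_wrt n B U) (module_vec TYPE(real) n)"
proof -
  interpret vec_space "TYPE(real)" n .
  show ?thesis
  proof (unfold submodule_def, intro conjI)
    show "module class_ring V" ..
    have "u \<bullet> (B *\<^sub>v 0\<^sub>v n) = 0" if "u \<in> U" for u
    proof -
      have "B *\<^sub>v 0\<^sub>v n = 0\<^sub>v n" using B by (intro eq_vecI) auto
      then show ?thesis using that U by auto
    qed
    then show "\<zero>\<^bsub>V\<^esub> \<in> orth_compl_wrt n B U"
      by (simp add: orth_compl_wrt_iff module_vec_simps)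
  qed (use B U in \<open>auto simp: orth_compl_wrt_iff module_vec_simps class_ring_simps
      mult_add_distrib_mat_vec[of B n n] scalar_prod_add_distrib[of _ n]
      mult_mat_vec[of B n n] subset_iff\<close>)
qed

text \<open>The range lies in the complement because every column of \<open>W\<close> does;
  injectivity is linear independence of the columns, where \<open>distinct\<close> excludes
  repetitions that \<open>set (cols W)\<close> would hide.\<close>

lemma columns_basis_mult_vec:
  assumes W: "W \<in> carrier_mat n m" and B: "B \<in> carrier_mat n n" and U: "U \<subseteq> carrier_vec n"
    and basis: "columns_basis n W (orth_compl_wrt n B U)" and x: "x \<in> carrier_vec m"
  shows "W *\<^sub>v x \<in> orth_compl_wrt n B U"
    and "W *\<^sub>v x = 0\<^sub>v n \<Longrightarrow> x = 0\<^sub>v m"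
proof -
  interpret vec_space "TYPE(real)" n .
  let ?E = "orth_compl_wrt n B U"
  have sub: "submodule class_ring ?E V" by (rule orth_compl_wrt_submodule[OF B U])
  have vs: "vectorspace class_ring (vs ?E)"
    using subspace_is_vs[of ?E] sub vectorspace_axioms by (simp add: subspace_def)
  from basis have dist: "distinct (cols W)" and li: "\<not> LinearCombinations.module.lin_dep class_ring (vs ?E) (set (cols W))"
    and cols: "set (cols W) \<subseteq> ?E"
    by (auto simp: columns_basis_def vectorspace.basis_def[OF vs])
  have "\<not> lin_dep (set (cols W))"
    using span_li_not_depend(2)[OF cols sub] li by simp
  then show "W *\<^sub>v x = 0\<^sub>v n \<Longrightarrow> x = 0\<^sub>v m"
    using lin_depI[OF W x _ _ dist] by blast
  have "u \<bullet> (B *\<^sub>v (W *\<^sub>v x)) = 0" if u: "u \<in> U" for u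
  proof -
    have uc: "u \<in> carrier_vec n" using u U by auto
    \<comment> \<open>These products are the entries of \<open>(B * W)\<^sup>T *\<^sub>v u\<close>,
      which therefore vanishes.\<close>
    have "col (B * W) j \<bullet> u = 0" if "j < m" for j
    proof -
      have "col W j \<in> ?E" using cols that W by (auto simp: cols_def)
      then show ?thesis
        using u uc that B W comm_scalar_prod[of u n "B *\<^sub>v col W j"] 
        by (auto simp: orth_compl_wrt_iff col_mult2[OF B W that])
    qed
    then have "(B * W)\<^sup>T *\<^sub>v u = 0\<^sub>v m"
      by (intro eq_vecI) (use B W in auto)
    then have "x \<bullet> ((B * W)\<^sup>T *\<^sub>v u) = 0" using x by simp
    moreover have "(B * W)\<^sup>T *\<^sub>v u \<in> carrier_vec m"
      using B W uc by (intro mult_mat_vec_carrier[of _ m n]) auto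
    then have "u \<bullet> ((B * W) *\<^sub>v x) = x \<bullet> ((B * W)\<^sup>T *\<^sub>v u)"
      using transpose_vec_mult_scalar[of "B * W" n m x u] B W x uc
       comm_scalar_prod[OF x] by auto
    ultimately show ?thesis using B W x by simp
  qed
  then show "W *\<^sub>v x \<in> ?E"
    using W x by (simp add: orth_compl_wrt_iff)
qed

section \<open>Symmetric forms and the maximal Rayleigh quotient\<close>

lemma spd_matsD:
  assumes "B \<in> spd_mats n"
  shows "B \<in> carrier_mat n n" "B\<^sup>T = B"
    "\<And>v. v \<in> carrier_vec n \<Longrightarrow> v \<noteq> 0\<^sub>v n \<Longrightarrow> v \<bullet> (B *\<^sub>v v) > 0"
  using assms by (auto simp: spd_mats_def sym_mats_def)

lemma bilinear_form_expand:
  fixes B :: "'a :: field mat"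
  assumes "B \<in> carrier_mat n n" "v \<in> carrier_vec n" "w \<in> carrier_vec n"
  shows "v \<bullet> (B *\<^sub>v w) = (\<Sum>i<n. \<Sum>j<n. v $ i * B $$ (i, j) * w $ j)"
  using assms by (auto simp: scalar_prod_def atLeast0LessThan sum_distrib_left mult.assoc intro!: sum.cong)

lemma symmetric_form_commute:
  fixes B :: "'a :: field mat"
  assumes B: "B \<in> carrier_mat n n" "B\<^sup>T = B" and v: "v \<in> carrier_vec n" and w: "w \<in> carrier_vec n"
  shows "v \<bullet> (B *\<^sub>v w) = w \<bullet> (B *\<^sub>v v)"
  using transpose_vec_mult_scalar[OF B(1) w v] comm_scalar_prod[of "B *\<^sub>v v" n w] B v w by auto

text \<open>Restricts the form to a line, so that the first variation at the Rayleigh maximizer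
  appears as the coefficient of \<open>s\<close>.\<close>

lemma symmetric_form_add_smult:
  fixes B :: "'a :: field mat"
  assumes B: "B \<in> carrier_mat n n" "B\<^sup>T = B" and v: "v \<in> carrier_vec n" and d: "d \<in> carrier_vec n"
  shows "(v + s \<cdot>\<^sub>v d) \<bullet> (B *\<^sub>v (v + s \<cdot>\<^sub>v d))
    = v \<bullet> (B *\<^sub>v v) + 2 * s * (d \<bullet> (B *\<^sub>v v)) + s\<^sup>2 * (d \<bullet> (B *\<^sub>v d))"
proof -
  have Bvd: "B *\<^sub>v v \<in> carrier_vec n" "B *\<^sub>v d \<in> carrier_vec n" using B v d by auto
  have "B *\<^sub>v (v + s \<cdot>\<^sub>v d) = B *\<^sub>v v + s \<cdot>\<^sub>v (B *\<^sub>v d)"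
    using B v d by (simp add: mult_add_distrib_mat_vec[of B n n] mult_mat_vec[of B n n])
  then have "(v + s \<cdot>\<^sub>v d) \<bullet> (B *\<^sub>v (v + s \<cdot>\<^sub>v d))
      = (v + s \<cdot>\<^sub>v d) \<bullet> (B *\<^sub>v v) + s * ((v + s \<cdot>\<^sub>v d) \<bullet> (B *\<^sub>v d))"
    using Bvd v d
    by (simp add: scalar_prod_add_distrib[of _ n] scalar_prod_smult_distrib[of _ n]
        del: smult_scalar_prod_distrib)
  also have "\<dots> = v \<bullet> (B *\<^sub>v v) + s * (d \<bullet> (B *\<^sub>v v)) + s * (v \<bullet> (B *\<^sub>v d) + s * (d \<bullet> (B *\<^sub>v d)))"
    using Bvd v d by (simp add: add_scalar_prod_distrib[of _ n])
  finally show ?thesis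
    using symmetric_form_commute[OF B v d] by (simp add: algebra_simps power2_eq_square)
qed

lemma quadratic_form_smult:
  fixes B :: "'a :: field mat"
  assumes "B \<in> carrier_mat n n" "v \<in> carrier_vec n"
  shows "(s \<cdot>\<^sub>v v) \<bullet> (B *\<^sub>v (s \<cdot>\<^sub>v v)) = s\<^sup>2 * (v \<bullet> (B *\<^sub>v v))"
  using assms by (simp add: mult_mat_vec[of B n n] power2_eq_square)

lemma orth_compl_wrt_smult:
  assumes "B \<in> carrier_mat n n" "U \<subseteq> carrier_vec n" "v \<in> orth_compl_wrt n B U"
  shows "s \<cdot>\<^sub>v v \<in> orth_compl_wrt n B U"
  using assms by (auto simp: orth_compl_wrt_iff mult_mat_vec[of B n n] subset_iff)

text \<open>The unit sphere is modelled in the product topology on functions, with all coordinates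
  from \<open>n\<close> on frozen at 0. The box is compact by Tychonoff, and the sphere is closed in
  it.\<close>

lemma compact_sphere_fun:
  "compact {f :: nat \<Rightarrow> real. (\<forall>i. f i \<in> (if i < n then {-1..1} else {0})) \<and> (\<Sum>i<n. (f i)\<^sup>2) = 1}"
proof -
  let ?S = "\<lambda>i. if i < n then {-1..1 :: real} else {0}"
  have "compactin (product_topology (\<lambda>i :: nat. euclidean) UNIV) (PiE UNIV ?S)"
    unfolding compactin_PiE by auto
  then have "compact (PiE UNIV ?S)"
    by (simp add: euclidean_product_topology)
  moreover have "closed {f :: nat \<Rightarrow> real. (\<Sum>i<n. (f i)\<^sup>2) = 1}"
    by (intro closed_Collect_eq continuous_intros continuous_on_product_coordinates)
  ultimately have "compact (PiE UNIV ?S \<inter> {f :: nat \<Rightarrow> real. (\<Sum>i<n. (f i)\<^sup>2) = 1})"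
    by (rule compact_Int_closed)
  also have "PiE UNIV ?S \<inter> {f :: nat \<Rightarrow> real. (\<Sum>i<n. (f i)\<^sup>2) = 1}
      = {f. (\<forall>i. f i \<in> ?S i) \<and> (\<Sum>i<n. (f i)\<^sup>2) = 1}"
    unfolding PiE_UNIV_domain Pi_def by blast
  finally show ?thesis .
qed

text \<open>The quotient is continuous on the compact set of unit vectors of the complement and
  homogeneous of degree 0, so its maximum there is global. Cross-multiplication makes the inequality
  meaningful at \<open>w = 0\<close> too.\<close>

lemma rayleigh_maximizer_exists:
  assumes M: "M \<in> spd_mats n" and B: "B \<in> spd_mats n" and U: "U \<subseteq> carrier_vec n"
    and v: "v \<in> orth_compl_wrt n B U" "v \<noteq> 0\<^sub>v n"
  obtains v0 where "v0 \<in> orth_compl_wrt n B U" "v0 \<noteq> 0\<^sub>v n"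
    "\<And>w. w \<in> orth_compl_wrt n B U \<Longrightarrow>
      (w \<bullet> (M *\<^sub>v w)) * (v0 \<bullet> (B *\<^sub>v v0)) \<le> (v0 \<bullet> (M *\<^sub>v v0)) * (w \<bullet> (B *\<^sub>v w))"
proof -
  let ?E = "orth_compl_wrt n B U"
  note Mc = spd_matsD[OF M] and Bc = spd_matsD[OF B]
  define S where "S = {f :: nat \<Rightarrow> real. (\<forall>i. f i \<in> (if i < n then {-1..1} else {0})) \<and> (\<Sum>i<n. (f i)\<^sup>2) = 1}"
  define q where "q C f = (\<Sum>i<n. \<Sum>j<n. f i * C $$ (i, j) * f j)" for C :: "real mat" and f :: "nat \<Rightarrow> real"
  have q: "q C f = vec n f \<bullet> (C *\<^sub>v vec n f)" if "C \<in> carrier_mat n n" for C f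
    using that by (simp add: q_def bilinear_form_expand)
  have cont_q: "continuous_on A (q C)" for A C
    unfolding q_def
    by (intro continuous_intros continuous_on_subset[OF continuous_on_product_coordinates]) auto
  have E_closed: "closed {f. vec n f \<in> ?E}"
  proof -
    \<comment> \<open>The complement is an intersection of zero sets of continuous linear
      functionals.\<close>
    have "{f. vec n f \<in> ?E} = (\<Inter>u\<in>U. {f. (\<Sum>i<n. \<Sum>j<n. u $ i * B $$ (i, j) * f j) = 0})"
      using U Bc(1) by (auto simp: orth_compl_wrt_iff bilinear_form_expand subset_iff)
    also have "closed \<dots>"
      by (intro closed_INT ballI closed_Collect_eq continuous_intros continuous_on_product_coordinates)
    finally show ?thesis .
  qed
  let ?K = "S \<inter> {f. vec n f \<in> ?E}"
  have K: "compact ?K"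
    unfolding S_def by (rule compact_Int_closed[OF compact_sphere_fun E_closed])
  have normalize: "\<exists>s f. s \<noteq> 0 \<and> f \<in> ?K \<and> vec n f = s \<cdot>\<^sub>v w" if w: "w \<in> ?E" "w \<noteq> 0\<^sub>v n" for w
  proof -
    have wc: "w \<in> carrier_vec n" using w by (simp add: orth_compl_wrt_iff)
    define N where "N = (\<Sum>i<n. (w $ i)\<^sup>2)"
    obtain i where "i < n" "w $ i \<noteq> 0"
      using w(2) wc by (metis carrier_vecD eq_vecI index_zero_vec)
    then have N: "N > 0"
      unfolding N_def by (intro sum_pos2[of _ i]) auto
    define f where "f = (\<lambda>i. if i < n then w $ i / sqrt N else 0)"
    have f1: "(\<Sum>i<n. (f i)\<^sup>2) = 1"
      using N by (simp add: f_def power_divide sum_divide_distrib[symmetric] N_def[symmetric])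
    have "\<bar>f i\<bar> \<le> 1" if "i < n" for i
    proof -
      have "(f i)\<^sup>2 \<le> (\<Sum>i<n. (f i)\<^sup>2)"
        by (rule member_le_sum) (use that in auto)
      then show ?thesis using f1 by (simp add: abs_square_le_1)
    qed
    then have "f \<in> S"
      using f1 by (auto simp: S_def abs_le_iff minus_le_iff) (auto simp: f_def)
    moreover have vf: "vec n f = (1 / sqrt N) \<cdot>\<^sub>v w"
      using wc by (intro eq_vecI) (auto simp: f_def)
    moreover have "vec n f \<in> ?E"
      unfolding vf by (rule orth_compl_wrt_smult[OF Bc(1) U w(1)])
    ultimately show ?thesis
      using N by (intro exI[of _ "1 / sqrt N"] exI[of _ f]) auto
  qed
  have nonzero: "vec n f \<noteq> 0\<^sub>v n" if "f \<in> S" for f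
  proof
    assume "vec n f = 0\<^sub>v n"
    then have "f i = 0" if "i < n" for i
      using that by (metis index_vec index_zero_vec(1))
    then show False using that by (simp add: S_def)
  qed
  have qpos: "q B f > 0" if "f \<in> S" for f
    using Bc(3)[of "vec n f"] nonzero[OF that] by (simp add: q[OF Bc(1)])
  have "?K \<noteq> {}" using normalize[OF v] by blast
  moreover have "continuous_on ?K (\<lambda>f. q M f / q B f)"
    by (intro continuous_on_divide cont_q) (use qpos in force)
  ultimately have "\<exists>f0 \<in> ?K. \<forall>f \<in> ?K. q M f / q B f \<le> q M f0 / q B f0"
    by (rule continuous_attains_sup[OF K])
  then obtain f0 where f0: "f0 \<in> ?K" "\<And>f. f \<in> ?K \<Longrightarrow> q M f / q B f \<le> q M f0 / q B f0"
    by blast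
  show thesis
  proof (rule that[of "vec n f0"])
    show "vec n f0 \<in> ?E" "vec n f0 \<noteq> 0\<^sub>v n" using f0 nonzero by auto
    fix w
    assume w: "w \<in> ?E"
    then have wc: "w \<in> carrier_vec n" by (simp add: orth_compl_wrt_iff)
    show "(w \<bullet> (M *\<^sub>v w)) * (vec n f0 \<bullet> (B *\<^sub>v vec n f0))
        \<le> (vec n f0 \<bullet> (M *\<^sub>v vec n f0)) * (w \<bullet> (B *\<^sub>v w))"
    proof (cases "w = 0\<^sub>v n")
      case True
      have "C *\<^sub>v 0\<^sub>v n = 0\<^sub>v n" if "C \<in> carrier_mat n n" for C :: "real mat"
        using that by (intro eq_vecI) auto
      then show ?thesis using True Mc(1) Bc(1) by simp
    next
      case False
      from normalize[OF w this] obtain s f where s: "s \<noteq> 0" and f: "f \<in> ?K" and vf: "vec n f = s \<cdot>\<^sub>v w"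
        by blast
      have "q M f * q B f0 \<le> q M f0 * q B f"
        using f0(2)[OF f] qpos[of f] qpos[of f0] f f0(1) by (simp add: divide_simps)
      then have "s\<^sup>2 * ((w \<bullet> (M *\<^sub>v w)) * q B f0) \<le> s\<^sup>2 * (q M f0 * (w \<bullet> (B *\<^sub>v w)))"
        by (simp add: q[OF Mc(1), of f] q[OF Bc(1), of f] vf mult_ac
            quadratic_form_smult[OF Mc(1) wc] quadratic_form_smult[OF Bc(1) wc])
      then show ?thesis
        using s by (simp add: q[OF Mc(1)] q[OF Bc(1)])
    qed
  qed
qed

lemma linear_coefficient_eq_0:
  fixes a b :: real
  assumes "\<And>s. 0 \<le> 2 * s * a + s\<^sup>2 * b"
  shows "a = 0"
proof (rule ccontr)
  assume "a \<noteq> 0"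
  \<comment> \<open>\<open>c\<close> is a positive bound for \<open>b\<close>, whatever its sign;
    \<open>s = - a / c\<close> minimizes \<open>2 s a + s^2 c\<close>, with value
    \<open>- a^2 / c\<close>.\<close>
  define c where "c = \<bar>b\<bar> + 1"
  have c: "c > 0" "b \<le> c" by (simp_all add: c_def)
  define s where "s = - a / c"
  have "2 * s * a + s\<^sup>2 * b \<le> 2 * s * a + s\<^sup>2 * c"
    by (intro add_left_mono mult_left_mono c) auto
  also have "\<dots> = - (a\<^sup>2 / c)"
    using c(1) by (simp add: s_def power2_eq_square field_simps)
  also have "\<dots> < 0"
    using \<open>a \<noteq> 0\<close> c(1) by simp
  finally show False using assms[of s] by simp
qed

lemma trivial_kernel_right_inverse:
  fixes B :: "'a :: field mat"
  assumes B: "B \<in> carrier_mat n n"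
    and ker: "\<And>x. x \<in> carrier_vec n \<Longrightarrow> B *\<^sub>v x = 0\<^sub>v n \<Longrightarrow> x = 0\<^sub>v n"
  obtains R where "R \<in> carrier_mat n n" "B * R = 1\<^sub>m n"
proof -
  have "det B \<noteq> 0"
    using det_0_iff_vec_prod_zero_field[OF B] ker by blast
  then have "B \<in> Units (ring_mat TYPE('a) n ())"
    using det_non_zero_imp_unit[OF B, where b = "()"] by simp
  then show thesis
    using that by (auto simp: Units_def ring_mat_simps)
qed

lemma spd_mat_solve:
  assumes B: "B \<in> spd_mats n" and b: "b \<in> carrier_vec n"
  obtains x where "x \<in> carrier_vec n" "B *\<^sub>v x = b"
proof -
  note Bc = spd_matsD[OF B]
  have "x = 0\<^sub>v n" if "x \<in> carrier_vec n" "B *\<^sub>v x = 0\<^sub>v n" for x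
    using Bc(3)[of x] that by force
  then obtain R where R: "R \<in> carrier_mat n n" "B * R = 1\<^sub>m n"
    using trivial_kernel_right_inverse[OF Bc(1)] by blast
  show thesis
    by (rule that[of "R *\<^sub>v b"])
      (use R b Bc(1) in \<open>auto simp: assoc_mult_mat_vec[of B n n R n b, symmetric]\<close>)
qed

text \<open>
  The maximizer \<open>v0\<close> of \<open>v\<^sup>T M v / v\<^sup>T B v\<close> on the complement is a generalized eigenvector, because
  the complement is invariant under \<open>B\<^sup>-\<^sup>1 M\<close>. Its eigenvalue is at least \<open>c\<close>: otherwise \<open>v0\<close> would
  lie in the low eigenspace and be \<open>B\<close>-orthogonal to itself.
\<close>
lemma low_eigenspace_compl_lower_bound:
  assumes M: "M \<in> spd_mats n" and B: "B \<in> spd_mats n"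
    and v: "v \<in> orth_compl_wrt n B (low_eigenspace n B M c)"
  shows "c * (v \<bullet> (M *\<^sub>v v)) \<le> v \<bullet> (B *\<^sub>v v)"
proof (cases "v = 0\<^sub>v n")
  case True
  have "C *\<^sub>v 0\<^sub>v n = 0\<^sub>v n" if "C \<in> carrier_mat n n" for C :: "real mat"
    using that by (intro eq_vecI) auto
  then show ?thesis using True spd_matsD(1)[OF M] spd_matsD(1)[OF B] by simp
next
  case False
  let ?U = "low_eigenspace n B M c"
  let ?E = "orth_compl_wrt n B ?U"
  note Mc = spd_matsD[OF M] and Bc = spd_matsD[OF B]
  obtain v0 where v0: "v0 \<in> ?E" "v0 \<noteq> 0\<^sub>v n"
    and max: "\<And>w. w \<in> ?E \<Longrightarrow>
      (w \<bullet> (M *\<^sub>v w)) * (v0 \<bullet> (B *\<^sub>v v0)) \<le> (v0 \<bullet> (M *\<^sub>v v0)) * (w \<bullet> (B *\<^sub>v w))"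
    using rayleigh_maximizer_exists[OF M B low_eigenspace_carrier v False] by blast
  have v0c: "v0 \<in> carrier_vec n" using v0 by (simp add: orth_compl_wrt_iff)
  define \<mu> where "\<mu> = (v0 \<bullet> (M *\<^sub>v v0)) / (v0 \<bullet> (B *\<^sub>v v0))"
  have pos: "v0 \<bullet> (M *\<^sub>v v0) > 0" "v0 \<bullet> (B *\<^sub>v v0) > 0"
    using Mc(3) Bc(3) v0 v0c by auto
  then have \<mu>: "\<mu> > 0" by (simp add: \<mu>_def)
  have bound: "w \<bullet> (M *\<^sub>v w) \<le> \<mu> * (w \<bullet> (B *\<^sub>v w))" if "w \<in> ?E" for w
    using max[OF that] pos by (simp add: \<mu>_def field_simps)
  have Mv0: "M *\<^sub>v v0 \<in> carrier_vec n" "B *\<^sub>v v0 \<in> carrier_vec n" using Mc Bc v0c by auto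
  obtain x where x: "x \<in> carrier_vec n" "B *\<^sub>v x = M *\<^sub>v v0"
    using spd_mat_solve[OF B Mv0(1)] .
  \<comment> \<open>For a generating eigenvector \<open>g\<close> with eigenvalue \<open>y\<close>,
    \<open>g\<^sup>T B x = g\<^sup>T M v0 = g\<^sup>T B v0 / y = 0\<close>; the span inherits
    this.\<close>
  have "x \<in> ?E"
    unfolding orth_compl_wrt_iff
  proof (intro conjI ballI)
    fix u assume u: "u \<in> ?U"
    let ?G = "{v \<in> carrier_vec n. v \<noteq> 0\<^sub>v n \<and> (\<exists>y. 0 < y \<and> y < c \<and> B *\<^sub>v v = y \<cdot>\<^sub>v (M *\<^sub>v v))}"
    have "g \<bullet> (M *\<^sub>v v0) = 0" if g: "g \<in> ?G" for g
    proof -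
      from g obtain y where y: "0 < y" "y < c" "B *\<^sub>v g = y \<cdot>\<^sub>v (M *\<^sub>v g)" and gc: "g \<in> carrier_vec n" "g \<noteq> 0\<^sub>v n"
        by auto
      have "g \<in> ?U"
        by (rule generalized_eigenvector_in_low_eigenspace) (use y gc in auto)
      then have "0 = v0 \<bullet> (B *\<^sub>v g)"
        using v0(1) symmetric_form_commute[OF Bc(1,2) v0c gc(1)] by (simp add: orth_compl_wrt_iff)
      also have "\<dots> = y * (v0 \<bullet> (M *\<^sub>v g))"
        unfolding y(3) using Mc(1) gc v0c by simp
      finally show ?thesis
        using y(1) symmetric_form_commute[OF Mc(1,2) v0c gc(1)] by simp
    qed
    moreover have "?G \<subseteq> carrier_vec n" by blast
    ultimately show "u \<bullet> (B *\<^sub>v x) = 0"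
      unfolding x(2)
      using scalar_prod_span_eq_0[of ?G n "M *\<^sub>v v0" u] Mv0(1) u[unfolded low_eigenspace_def] by blast
  qed (rule x(1))
  \<comment> \<open>Up to a factor, \<open>d\<close> is the gradient at \<open>v0\<close> of
    \<open>w\<^sup>T M w - \<mu> w\<^sup>T B w\<close> in the inner product of \<open>B\<close>. It
    lies in the complement, hence is an admissible direction, and the first variation along it is a
    multiple of \<open>d\<^sup>T B d\<close>.\<close>
  define d where "d = x + (- \<mu>) \<cdot>\<^sub>v v0"
  have dc: "d \<in> carrier_vec n" using x v0c by (simp add: d_def)
  have sub: "w + s \<cdot>\<^sub>v w' \<in> ?E" if "w \<in> ?E" "w' \<in> ?E" for w w' s
    using that orth_compl_wrt_smult[OF Bc(1) low_eigenspace_carrier that(2), of s]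
      low_eigenspace_carrier[of n B M c] Bc(1)
    by (auto simp: orth_compl_wrt_iff mult_add_distrib_mat_vec[of B n n] scalar_prod_add_distrib[of _ n] subset_iff)
  have dE: "d \<in> ?E" unfolding d_def by (rule sub) fact+
  have Bd: "B *\<^sub>v d = M *\<^sub>v v0 + (- \<mu>) \<cdot>\<^sub>v (B *\<^sub>v v0)"
    unfolding d_def using Bc(1) x v0c
    by (simp add: mult_add_distrib_mat_vec[of B n n] mult_mat_vec[of B n n])
  \<comment> \<open>On the line \<open>v0 + s d\<close> the difference
    \<open>\<mu> w\<^sup>T B w - w\<^sup>T M w\<close> is nonnegative and vanishes at
    \<open>s = 0\<close>.\<close>
  have "\<mu> * (d \<bullet> (B *\<^sub>v v0)) - d \<bullet> (M *\<^sub>v v0) = 0"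
  proof (rule linear_coefficient_eq_0)
    fix s
    have "(v0 + s \<cdot>\<^sub>v d) \<bullet> (M *\<^sub>v (v0 + s \<cdot>\<^sub>v d)) \<le> \<mu> * ((v0 + s \<cdot>\<^sub>v d) \<bullet> (B *\<^sub>v (v0 + s \<cdot>\<^sub>v d)))"
      by (rule bound[OF sub[OF v0(1) dE]])
    moreover have "v0 \<bullet> (M *\<^sub>v v0) = \<mu> * (v0 \<bullet> (B *\<^sub>v v0))"
      using pos by (simp add: \<mu>_def)
    ultimately show "0 \<le> 2 * s * (\<mu> * (d \<bullet> (B *\<^sub>v v0)) - d \<bullet> (M *\<^sub>v v0))
        + s\<^sup>2 * (\<mu> * (d \<bullet> (B *\<^sub>v d)) - d \<bullet> (M *\<^sub>v d))"
      unfolding symmetric_form_add_smult[OF Mc(1,2) v0c dc] symmetric_form_add_smult[OF Bc(1,2) v0c dc]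
      by (simp add: algebra_simps)
  qed
  then have "d \<bullet> (B *\<^sub>v d) = 0"
    unfolding Bd using dc Mv0 by (simp add: scalar_prod_add_distrib[of _ n])
  then have "d = 0\<^sub>v n" using Bc(3)[OF dc] by auto
  then have "B *\<^sub>v d = 0\<^sub>v n" using Bc(1) by (intro eq_vecI) auto
  then have Mv0_eq: "(M *\<^sub>v v0) $ i = \<mu> * (B *\<^sub>v v0) $ i" if "i < n" for i
  proof -
    have "(B *\<^sub>v d) $ i = 0" using \<open>B *\<^sub>v d = 0\<^sub>v n\<close> that by simp
    then show ?thesis
      unfolding Bd using that carrier_vecD[OF Mv0(1)] carrier_vecD[OF Mv0(2)]
      by (simp del: index_mult_mat_vec dim_mult_mat_vec)
  qed
  have eig: "B *\<^sub>v v0 = (1 / \<mu>) \<cdot>\<^sub>v (M *\<^sub>v v0)"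
    by (rule eq_vecI)
      (use Mv0_eq \<mu> carrier_vecD[OF Mv0(1)] carrier_vecD[OF Mv0(2)] in
        \<open>simp_all del: index_mult_mat_vec dim_mult_mat_vec\<close>)
  have "c * \<mu> \<le> 1"
  proof (rule ccontr)
    assume "\<not> c * \<mu> \<le> 1"
    then have "1 / \<mu> < c" using \<mu> by (simp add: divide_simps)
    then have "v0 \<in> ?U"
      by (intro generalized_eigenvector_in_low_eigenspace[OF v0c v0(2) _ _ eig]) (use \<mu> in auto)
    then show False using v0(1) pos(2) by (simp add: orth_compl_wrt_iff)
  qed
  have vc: "v \<in> carrier_vec n" using v by (simp add: orth_compl_wrt_iff)
  show ?thesis
  \<comment> \<open>Multiplying \<open>bound\<close> by \<open>c\<close> requires
    \<open>c \<ge> 0\<close>; for negative \<open>c\<close> the left side is nonpositive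
    anyway.\<close>
  proof (cases "c \<ge> 0")
    case True
    have "c * (v \<bullet> (M *\<^sub>v v)) \<le> c * (\<mu> * (v \<bullet> (B *\<^sub>v v)))"
      by (rule mult_left_mono[OF bound[OF v] True])
    also have "\<dots> \<le> 1 * (v \<bullet> (B *\<^sub>v v))"
      unfolding mult.assoc[symmetric]
      by (rule mult_right_mono[OF \<open>c * \<mu> \<le> 1\<close>]) (use Bc(3)[OF vc False] in simp)
    finally show ?thesis by simp
  next
    case neg: False
    then have "c * (v \<bullet> (M *\<^sub>v v)) \<le> 0"
      using Mc(3)[OF vc False] by (simp add: mult_nonpos_nonneg)
    then show ?thesis using Bc(3)[OF vc False] by simp
  qed
qed

section \<open>Invertibility of the shifted compression\<close>

lemma hermitian_form_expand:
  fixes C :: "complex mat"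
  assumes "C \<in> carrier_mat n n" "y \<in> carrier_vec n"
  shows "(C *\<^sub>v y) \<bullet>c y = (\<Sum>i<n. \<Sum>j<n. C $$ (i, j) * y $ j * cnj (y $ i))"
  using assms by (auto simp: scalar_prod_def atLeast0LessThan sum_distrib_right conjugate_complex_def intro!: sum.cong)

text \<open>For a real matrix the cross terms between real and imaginary parts are purely imaginary,
  so real estimates apply to both parts separately.\<close>

lemma Re_hermitian_form:
  assumes B: "B \<in> carrier_mat n n" and y: "y \<in> carrier_vec n"
  shows "Re ((cmat B *\<^sub>v y) \<bullet>c y)
    = map_vec Re y \<bullet> (B *\<^sub>v map_vec Re y) + map_vec Im y \<bullet> (B *\<^sub>v map_vec Im y)"
proof -
  have "Re ((cmat B *\<^sub>v y) \<bullet>c y)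
      = (\<Sum>i<n. \<Sum>j<n. Re (y $ i) * B $$ (i, j) * Re (y $ j) + Im (y $ i) * B $$ (i, j) * Im (y $ j))"
    using B y by (subst hermitian_form_expand[of _ n]) (auto simp: algebra_simps intro!: sum.cong)
  also have "\<dots> = map_vec Re y \<bullet> (B *\<^sub>v map_vec Re y) + map_vec Im y \<bullet> (B *\<^sub>v map_vec Im y)"
    using B y by (simp add: bilinear_form_expand[of _ n] sum.distrib)
  finally show ?thesis .
qed

lemma map_vec_Re_cmat_mult:
  assumes "W \<in> carrier_mat n m" "x \<in> carrier_vec m"
  shows "map_vec Re (cmat W *\<^sub>v x) = W *\<^sub>v map_vec Re x"
  using assms by (intro eq_vecI) (auto simp: scalar_prod_def)

lemma map_vec_Im_cmat_mult:
  assumes "W \<in> carrier_mat n m" "x \<in> carrier_vec m"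
  shows "map_vec Im (cmat W *\<^sub>v x) = W *\<^sub>v map_vec Im x"
  using assms by (intro eq_vecI) (auto simp: scalar_prod_def)

section \<open>Compressions by a real basis matrix\<close>

lemma compress_carrier:
  "W \<in> carrier_mat n m \<Longrightarrow> compress W B \<in> carrier_mat m m"
  unfolding compress_def by auto

text \<open>Since \<open>W\<close> is real, it commutes with conjugation and its transpose acts as
  its adjoint.\<close>

lemma compress_hermitian_form:
  assumes W: "W \<in> carrier_mat n m" and C: "C \<in> carrier_mat n n" and x: "x \<in> carrier_vec m"
  shows "(compress (cmat W) C *\<^sub>v x) \<bullet>c x = (C *\<^sub>v (cmat W *\<^sub>v x)) \<bullet>c (cmat W *\<^sub>v x)"
proof -
  have Wc: "cmat W \<in> carrier_mat n m" using W by simp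
  let ?z = "C *\<^sub>v (cmat W *\<^sub>v x)"
  have z: "?z \<in> carrier_vec n" using C Wc x by auto
  have "compress (cmat W) C *\<^sub>v x = (cmat W)\<^sup>T *\<^sub>v ?z"
  proof -
    have WT: "(cmat W)\<^sup>T \<in> carrier_mat m n" using Wc by simp
    have Wx: "cmat W *\<^sub>v x \<in> carrier_vec n" using Wc x by simp
    show ?thesis
      unfolding compress_def assoc_mult_mat_vec[OF mult_carrier_mat[OF WT C] Wc x]
      by (rule assoc_mult_mat_vec[OF WT C Wx])
  qed
  moreover have "((cmat W)\<^sup>T *\<^sub>v ?z) \<bullet>c x = ?z \<bullet> (cmat W *\<^sub>v conjugate x)"
    by (rule transpose_vec_mult_scalar[OF Wc _ z]) (use x in simp)
  moreover have "cmat W *\<^sub>v conjugate x = conjugate (cmat W *\<^sub>v x)"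
    using W x by (intro eq_vecI) (auto simp: scalar_prod_def conjugate_complex_def)
  ultimately show ?thesis by simp
qed

lemma compress_entry:
  fixes W :: "'a :: comm_ring_1 mat"
  assumes W: "W \<in> carrier_mat n m" and B: "B \<in> carrier_mat n n" and ij: "i < m" "j < m"
  shows "compress W B $$ (i, j) = (\<Sum>a<n. \<Sum>b<n. W $$ (a, i) * B $$ (a, b) * W $$ (b, j))"
proof -
  have WT: "W\<^sup>T \<in> carrier_mat m n" using W by simp
  have "compress W B $$ (i, j) = (\<Sum>b<n. (\<Sum>a<n. W $$ (a, i) * B $$ (a, b)) * W $$ (b, j))"
    unfolding compress_def mult_mat_entry[OF mult_carrier_mat[OF WT B] W ij]
  proof (intro sum.cong refl arg_cong2[where f = "(*)"])
    fix b assume "b \<in> {..<n}"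
    then show "(W\<^sup>T * B) $$ (i, b) = (\<Sum>a<n. W $$ (a, i) * B $$ (a, b))"
      using mult_mat_entry[OF WT B ij(1), of b] W ij by simp
  qed
  then show ?thesis
    by (subst sum.swap) (simp add: sum_distrib_right)
qed

text \<open>Compression is linear in the matrix, so the compressed family is again an affine pencil,
  now of size \<open>m\<close>, and \<open>affine_pencil_inverse\<close> applies.\<close>

lemma compress_affine_mat:
  fixes W :: "'a :: comm_ring_1 mat"
  assumes W: "W \<in> carrier_mat n m" and "A0 \<in> carrier_mat n n" and "\<And>l. A l \<in> carrier_mat n n"
  shows "compress W (affine_mat n A0 A \<sigma>) = affine_mat m (compress W A0) (\<lambda>l. compress W (A l)) \<sigma>"
proof (rule eq_matI)
  fix i j
  assume "i < dim_row (affine_mat m (compress W A0) (\<lambda>l. compress W (A l)) \<sigma>)"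
    "j < dim_col (affine_mat m (compress W A0) (\<lambda>l. compress W (A l)) \<sigma>)"
  then have ij: "i < m" "j < m" by (auto simp: affine_mat_def)
  have "compress W (affine_mat n A0 A \<sigma>) $$ (i, j)
      = (\<Sum>a<n. \<Sum>b<n. W $$ (a, i) * A0 $$ (a, b) * W $$ (b, j)
          + (\<Sum>l\<in>UNIV. vec_nth \<sigma> l * (W $$ (a, i) * A l $$ (a, b) * W $$ (b, j))))"
    unfolding compress_entry[OF W affine_mat_carrier ij]
    by (intro sum.cong refl)
      (simp add: affine_mat_entry algebra_simps sum_distrib_left sum_distrib_right)
  also have "\<dots> = compress W A0 $$ (i, j)
      + (\<Sum>a<n. \<Sum>l\<in>UNIV. \<Sum>b<n. vec_nth \<sigma> l * (W $$ (a, i) * A l $$ (a, b) * W $$ (b, j)))"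
    unfolding compress_entry[OF W assms(2) ij] sum.distrib
    by (subst (2) sum.swap) simp
  also have "\<dots> = compress W A0 $$ (i, j) + (\<Sum>l\<in>UNIV. vec_nth \<sigma> l * compress W (A l) $$ (i, j))"
    unfolding compress_entry[OF W assms(3) ij]
    by (subst sum.swap) (simp add: sum_distrib_left)
  finally show "compress W (affine_mat n A0 A \<sigma>) $$ (i, j)
      = affine_mat m (compress W A0) (\<lambda>l. compress W (A l)) \<sigma> $$ (i, j)"
    by (simp add: affine_mat_entry ij)
qed (use compress_carrier[OF W] in \<open>auto simp: affine_mat_def\<close>)

lemma affine_mat_recenter:
  assumes "K \<in> carrier_mat n n"
  shows "affine_mat n N B \<sigma> - K = affine_mat n (affine_mat n N B \<sigma>0 - K) B (\<sigma> - \<sigma>0)"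
  using assms
  by (intro eq_matI) (auto simp: affine_mat_def sum.distrib[symmetric] algebra_simps)

text \<open>Separates the real point \<open>s\<close> from the rest. \<open>A0\<close> is subtracted
  because the pencil at \<open>\<sigma> - cpoint s\<close> contains it a second time.\<close>

lemma hermitian_form_affine_split:
  assumes A: "A0 \<in> carrier_mat n n" "\<And>l. A l \<in> carrier_mat n n" and y: "y \<in> carrier_vec n"
  shows "(caffine_mat n A0 A \<sigma> *\<^sub>v y) \<bullet>c y
    = (cmat (affine_mat n A0 A s) *\<^sub>v y) \<bullet>c y
      + ((caffine_mat n A0 A (\<sigma> - cpoint s) *\<^sub>v y) \<bullet>c y - (cmat A0 *\<^sub>v y) \<bullet>c y)"
proof -
  have entry: "caffine_mat n A0 A \<sigma> $$ (i, j) = cmat (affine_mat n A0 A s) $$ (i, j)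
      + (caffine_mat n A0 A (\<sigma> - cpoint s) $$ (i, j) - cmat A0 $$ (i, j))" if "i < n" "j < n" for i j
    using that A by (auto simp: affine_mat_def cpoint_def carrier_matD[of "A _" n n]
        sum.distrib[symmetric] algebra_simps)
  have A0c: "cmat A0 \<in> carrier_mat n n" and As: "cmat (affine_mat n A0 A s) \<in> carrier_mat n n"
    using A by simp_all
  show ?thesis
    unfolding hermitian_form_expand[OF affine_mat_carrier y] hermitian_form_expand[OF A0c y]
      hermitian_form_expand[OF As y] sum.distrib[symmetric] sum_subtractf[symmetric]
    by (intro sum.cong refl, subst entry) (auto simp: ring_distribs)
qed

lemma diff_hermitian_form:
  fixes C :: "complex mat"
  assumes "C \<in> carrier_mat n n" "D \<in> carrier_mat n n" "x \<in> carrier_vec n"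
  shows "((C - D) *\<^sub>v x) \<bullet>c x = (C *\<^sub>v x) \<bullet>c x - (D *\<^sub>v x) \<bullet>c x"
  unfolding hermitian_form_expand[OF assms(1,3)] hermitian_form_expand[OF assms(2,3)]
    hermitian_form_expand[OF minus_carrier_mat[OF assms(2)] assms(3)] sum_subtractf[symmetric]
  using assms by (intro sum.cong refl) (simp add: algebra_simps)

lemma smult_hermitian_form:
  fixes C :: "complex mat"
  assumes "C \<in> carrier_mat n n" "x \<in> carrier_vec n"
  shows "((k \<cdot>\<^sub>m C) *\<^sub>v x) \<bullet>c x = k * ((C *\<^sub>v x) \<bullet>c x)"
  unfolding hermitian_form_expand[OF assms]
    hermitian_form_expand[OF smult_carrier_mat[OF assms(1)] assms(2)] sum_distrib_left
  using assms by (intro sum.cong refl) (simp add: algebra_simps)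

text \<open>A right inverse of a square matrix over a field is two-sided; this excludes
  \<open>None\<close> and fixes the value under \<open>the\<close>.\<close>

lemma mat_inverse_eqI:
  fixes P :: "'a :: field mat"
  assumes P: "P \<in> carrier_mat m m" and G: "G \<in> carrier_mat m m" and PG: "P * G = 1\<^sub>m m"
  shows "invertible_mat P" "the (mat_inverse P) = G"
proof -
  have GP: "G * P = 1\<^sub>m m" by (rule mat_mult_left_right_inverse[OF P G PG])
  show "invertible_mat P"
    unfolding invertible_mat_def inverts_mat_def using P G PG GP by auto
  have "P \<in> Units (ring_mat TYPE('a) m ())"
    unfolding Units_def ring_mat_simps using P G PG GP by auto
  then obtain G' where G': "mat_inverse P = Some G'"
    using mat_inverse(1)[OF P, where b = "()"] by (cases "mat_inverse P") auto
  from mat_inverse(2)[OF P this] have "P * G' = 1\<^sub>m m" "G' \<in> carrier_mat m m" by auto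
  then have "(G * P) * G' = G * 1\<^sub>m m"
    using assoc_mult_mat[OF G P] by metis
  then have "G' = G"
    unfolding GP using \<open>G' \<in> carrier_mat m m\<close> G by simp
  then show "the (mat_inverse P) = G" using G' by simp
qed

lemma analyticity_domainD:
  assumes \<sigma>: "\<sigma> \<in> analyticity_domain n m A0 A M W \<pi> c" and x: "x \<in> carrier_vec m" "x \<noteq> 0\<^sub>v m"
    and pos: "Re ((compress (cmat W) (cmat M) *\<^sub>v x) \<bullet>c x) > 0"
  shows "cmod ((delta_perp n A0 A W (\<sigma> - cpoint (\<pi> \<sigma>)) *\<^sub>v x) \<bullet>c x)
    < c * Re ((compress (cmat W) (cmat M) *\<^sub>v x) \<bullet>c x)"
proof -
  let ?Q = "\<lambda>x. cmod ((delta_perp n A0 A W (\<sigma> - cpoint (\<pi> \<sigma>)) *\<^sub>v x) \<bullet>c x)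
      / Re ((compress (cmat W) (cmat M) *\<^sub>v x) \<bullet>c x)"
  have "ereal (?Q x) \<le> (SUP x \<in> {x \<in> carrier_vec m. x \<noteq> 0\<^sub>v m}. ereal (?Q x))"
    by (rule SUP_upper) (use x in simp)
  also have "\<dots> < ereal c"
    using \<sigma> by (simp add: analyticity_domain_def)
  finally have "?Q x < c" by simp
  then show ?thesis using pos by (simp add: divide_simps)
qed

lemma shifted_perp_trivial_kernel:
  assumes M: "M \<in> spd_mats n" and A0: "A0 \<in> sym_mats n" and A: "\<And>l. A l \<in> sym_mats n"
    and B: "Abar \<in> spd_mats n" and "\<alpha> > 0" and "t < \<Lambda>"
    and se: "spectrally_equivalent n S (affine_mat n A0 A) Abar \<alpha> \<beta>"
    and W: "W \<in> carrier_mat n m"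
    and basis: "columns_basis n W (orth_compl_wrt n Abar (low_eigenspace n Abar M (\<rho> * \<Lambda>)))"
    and s: "\<pi> \<sigma> \<in> S"
    and \<sigma>: "\<sigma> \<in> analyticity_domain n m A0 A M W \<pi> ((\<alpha> * \<rho> - 1) * \<Lambda>)"
    and x: "x \<in> carrier_vec m" and ker: "shifted_perp n A0 A M W \<sigma> t *\<^sub>v x = 0\<^sub>v m"
  shows "x = 0\<^sub>v m"
proof (rule ccontr)
  assume x0: "x \<noteq> 0\<^sub>v m"
  let ?E = "orth_compl_wrt n Abar (low_eigenspace n Abar M (\<rho> * \<Lambda>))"
  let ?s = "\<pi> \<sigma>"
  note Mc = spd_matsD[OF M] and Bc = spd_matsD[OF B]
  have A0c: "A0 \<in> carrier_mat n n" and Ac: "\<And>l. A l \<in> carrier_mat n n"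
    using A0 A by (auto simp: sym_mats_def)
  have Wc: "cmat W \<in> carrier_mat n m" using W by simp
  define y where "y = cmat W *\<^sub>v x"
  have y: "y \<in> carrier_vec n" using W x by (simp add: y_def)
  \<comment> \<open>As \<open>W\<close> is real, the real and imaginary parts of \<open>W x\<close>
    both lie in the complement, where the Rayleigh bound holds.\<close>
  define a where "a = W *\<^sub>v map_vec Re x"
  define b where "b = W *\<^sub>v map_vec Im x"
  have ReIm: "map_vec Re y = a" "map_vec Im y = b"
    unfolding y_def a_def b_def by (rule map_vec_Re_cmat_mult[OF W x] map_vec_Im_cmat_mult[OF W x])+
  have ab: "a \<in> ?E" "b \<in> ?E"
    unfolding a_def b_def
    by (rule columns_basis_mult_vec(1)[OF W Bc(1) low_eigenspace_carrier basis]; use x in simp)+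
  have abc: "a \<in> carrier_vec n" "b \<in> carrier_vec n" using ab by (simp_all add: orth_compl_wrt_iff)
  have "a \<noteq> 0\<^sub>v n \<or> b \<noteq> 0\<^sub>v n"
  proof (rule ccontr)
    assume "\<not> ?thesis"
    then have "map_vec Re x = 0\<^sub>v m" "map_vec Im x = 0\<^sub>v m"
      unfolding a_def b_def
      using columns_basis_mult_vec(2)[OF W Bc(1) low_eigenspace_carrier basis] x by auto
    then have "Re (x $ i) = 0" "Im (x $ i) = 0" if "i < m" for i
      using that x by (metis carrier_vecD index_map_vec(1) index_zero_vec(1))+
    then have "x = 0\<^sub>v m" using x by (intro eq_vecI) (auto simp: complex_eq_iff)
    then show False using x0 by simp
  qed
  have nonneg: "v \<bullet> (C *\<^sub>v v) \<ge> 0" if "C \<in> spd_mats n" "v \<in> carrier_vec n" for C v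
  proof (cases "v = 0\<^sub>v n")
    case True
    have "C *\<^sub>v 0\<^sub>v n = 0\<^sub>v n" using spd_matsD(1)[OF that(1)] by (intro eq_vecI) auto
    then show ?thesis using True by simp
  qed (use spd_matsD(3)[OF that] in force)
  define q where "q C = a \<bullet> (C *\<^sub>v a) + b \<bullet> (C *\<^sub>v b)" for C
  have form: "Re ((cmat C *\<^sub>v y) \<bullet>c y) = q C" if "C \<in> carrier_mat n n" for C
    using Re_hermitian_form[OF that y] by (simp add: q_def ReIm)
  have qM: "q M > 0"
    using \<open>a \<noteq> 0\<^sub>v n \<or> b \<noteq> 0\<^sub>v n\<close> Mc(3)[OF abc(1)] Mc(3)[OF abc(2)]
      nonneg[OF M abc(1)] nonneg[OF M abc(2)]
    unfolding q_def by linarith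
  have "\<alpha> * (\<rho> * \<Lambda> * q M) \<le> \<alpha> * q Abar"
    using low_eigenspace_compl_lower_bound[OF M B ab(1)] low_eigenspace_compl_lower_bound[OF M B ab(2)]
      \<open>\<alpha> > 0\<close> unfolding q_def by (intro mult_left_mono) (simp_all add: distrib_left)
  also have "\<alpha> * q Abar \<le> q (affine_mat n A0 A ?s)"
    using se s abc by (auto simp: spectrally_equivalent_def q_def distrib_left intro!: add_mono)
  finally have lower: "\<alpha> * (\<rho> * \<Lambda> * q M) \<le> q (affine_mat n A0 A ?s)" .
  define \<delta> where "\<delta> = (delta_perp n A0 A W (\<sigma> - cpoint ?s) *\<^sub>v x) \<bullet>c x"
  have formM: "Re ((compress (cmat W) (cmat M) *\<^sub>v x) \<bullet>c x) = q M"
    using compress_hermitian_form[OF W _ x, of "cmat M"] form[OF Mc(1)] Mc(1) by (simp add: y_def)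
  have "cmod \<delta> < (\<alpha> * \<rho> - 1) * \<Lambda> * q M"
    using analyticity_domainD[OF \<sigma> x x0] qM unfolding formM \<delta>_def by blast
  then have \<delta>: "Re \<delta> > - ((\<alpha> * \<rho> - 1) * \<Lambda> * q M)"
    using abs_Re_le_cmod[of \<delta>] by linarith
  have \<delta>_eq: "\<delta> = (caffine_mat n A0 A (\<sigma> - cpoint ?s) *\<^sub>v y) \<bullet>c y - (cmat A0 *\<^sub>v y) \<bullet>c y"
    unfolding \<delta>_def delta_perp_def y_def
    by (subst diff_hermitian_form[OF compress_carrier[OF Wc] compress_carrier[OF Wc] x])
      (use A0c in \<open>simp add: compress_hermitian_form[OF W _ x]\<close>)
  \<comment> \<open>Testing the kernel equation with \<open>x\<close> itself; only the real part is
    then compared with the bounds.\<close>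
  have "0 = (shifted_perp n A0 A M W \<sigma> t *\<^sub>v x) \<bullet>c x"
    unfolding ker using x by simp
  also have "\<dots> = (caffine_mat n A0 A \<sigma> *\<^sub>v y) \<bullet>c y - complex_of_real t * ((cmat M *\<^sub>v y) \<bullet>c y)"
    unfolding shifted_perp_def y_def using compress_carrier[OF Wc] Mc(1)
    by (simp add: diff_hermitian_form[of _ m, OF _ _ x] smult_hermitian_form[of _ m, OF _ x]
        compress_hermitian_form[OF W _ x])
  also have "(caffine_mat n A0 A \<sigma> *\<^sub>v y) \<bullet>c y = (cmat (affine_mat n A0 A ?s) *\<^sub>v y) \<bullet>c y + \<delta>"
    unfolding \<delta>_eq by (rule hermitian_form_affine_split[OF A0c Ac y])
  finally have "Re 0 = Re ((cmat (affine_mat n A0 A ?s) *\<^sub>v y) \<bullet>c y + \<delta>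
      - complex_of_real t * ((cmat M *\<^sub>v y) \<bullet>c y))"
    by (rule arg_cong)
  then have "0 = q (affine_mat n A0 A ?s) + Re \<delta> - t * q M"
    by (simp only: minus_complex.sel plus_complex.sel times_complex.sel Re_complex_of_real Im_complex_of_real mult_zero_left diff_zero
        form[OF affine_mat_carrier] form[OF Mc(1)] zero_complex.sel)
  \<comment> \<open>Here \<open>\<alpha> \<rho> \<Lambda> - (\<alpha> \<rho> - 1) \<Lambda> =
    \<Lambda>\<close> is what remains against \<open>t\<close>.\<close>
  with lower \<delta> have "(\<Lambda> - t) * q M < 0"
    by (simp add: algebra_simps)
  then show False using qM \<open>t < \<Lambda>\<close> by (simp add: mult_less_0_iff)
qed

section \<open>Analyticity of \<open>Z\<close> near a point of the domain\<close>

theorem corollary4p1: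
  fixes n m :: nat
    and S :: "(real ^ 'd) set"
    and A0 Abar M W :: "real mat"
    and A :: "'d \<Rightarrow> real mat"
    and \<alpha> \<beta> \<Lambda> \<rho> t :: real
    and \<pi> :: "complex ^ 'd \<Rightarrow> real ^ 'd"
    and \<sigma>0 :: "complex ^ 'd"
  assumes "bounded S"
    and "M \<in> spd_mats n"
    and "A0 \<in> sym_mats n"
    and "\<And>l. A l \<in> sym_mats n"
    and "\<And>s. s \<in> S \<Longrightarrow> affine_mat n A0 A s \<in> spd_mats n"
    and "Abar \<in> spd_mats n"
    and "\<alpha> > 0" and "\<beta> > 0"
    and "spectrally_equivalent n S (affine_mat n A0 A) Abar \<alpha> \<beta>"
    and "\<Lambda> > 0" and "\<rho> > 1" and "\<alpha> * \<rho> > 1"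
    and "m = vectorspace.dim class_ring
               (subspace_of n (orth_compl_wrt n Abar (low_eigenspace n Abar M (\<rho> * \<Lambda>))))"
    and "W \<in> carrier_mat n m"
    and "columns_basis n W (orth_compl_wrt n Abar (low_eigenspace n Abar M (\<rho> * \<Lambda>)))"
    and "\<And>\<sigma>. is_closest S \<sigma> (\<pi> \<sigma>)"
    and "0 < t" and "t < \<Lambda>"
    and "\<sigma>0 \<in> analyticity_domain n m A0 A M W \<pi> ((\<alpha> * \<rho> - 1) * \<Lambda>)"
  shows "\<exists>r > 0. \<exists>C. (\<forall>k. C k \<in> carrier_mat n n) \<and>
           (\<forall>\<sigma> \<in> ball \<sigma>0 r.
              invertible_mat (shifted_perp n A0 A M W \<sigma> t) \<and>
              Z_mat n A0 A Abar M W \<sigma> t \<in> carrier_mat n n \<and>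
              power_series_at n (\<lambda>\<sigma>. Z_mat n A0 A Abar M W \<sigma> t) C \<sigma>0 \<sigma>)"
proof -
  let ?P = "\<lambda>\<sigma>. shifted_perp n A0 A M W \<sigma> t"
  let ?Z = "\<lambda>\<sigma>. Z_mat n A0 A Abar M W \<sigma> t"
  have W: "cmat W \<in> carrier_mat n m" using assms(14) by simp
  have A0: "A0 \<in> carrier_mat n n" and A: "A l \<in> carrier_mat n n" for l
    using assms(3,4) by (auto simp: sym_mats_def)
  have Abar: "Abar \<in> carrier_mat n n" using spd_matsD(1)[OF assms(6)] .
  have P: "?P \<sigma> \<in> carrier_mat m m" for \<sigma>
    unfolding shifted_perp_def
    by (rule minus_carrier_mat[OF smult_carrier_mat[OF compress_carrier[OF W]]])
  \<comment> \<open>The domain condition is applied at the centre only. Invertibility at nearby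
    points comes from the Neumann series, so jumps of the closest point map do no harm.\<close>
  have "x = 0\<^sub>v m" if "x \<in> carrier_vec m" "?P \<sigma>0 *\<^sub>v x = 0\<^sub>v m" for x
    by (rule shifted_perp_trivial_kernel[OF assms(2,3,4,6,7,18,9,14,15) _ assms(19) that])
      (use assms(16) in \<open>auto simp: is_closest_def\<close>)
  then obtain R where R: "R \<in> carrier_mat m m" "?P \<sigma>0 * R = 1\<^sub>m m"
    using trivial_kernel_right_inverse[OF P] by blast
  let ?B = "\<lambda>l. compress (cmat W) (cmat (A l))"
  have B: "?B l \<in> carrier_mat m m" for l by (rule compress_carrier[OF W])
  obtain r G where r: "r > 0" and G: "\<And>\<sigma>. G \<sigma> \<in> carrier_mat m m"
    and inv: "\<And>\<sigma>. \<sigma> \<in> ball \<sigma>0 r \<Longrightarrow> affine_mat m (?P \<sigma>0) ?B (\<sigma> - \<sigma>0) * G \<sigma> = 1\<^sub>m m"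
    and an: "\<And>i j. i < m \<Longrightarrow> j < m \<Longrightarrow> analytic_near \<sigma>0 r (\<lambda>\<sigma>. G \<sigma> $$ (i, j))"
    using affine_pencil_inverse[of "?P \<sigma>0" m R ?B \<sigma>0, OF P R B] by metis
  have pencil: "?P \<sigma> = affine_mat m (?P \<sigma>0) ?B (\<sigma> - \<sigma>0)" for \<sigma>
    unfolding shifted_perp_def
    using A0 A compress_carrier[OF W]
    by (simp add: compress_affine_mat[OF W] affine_mat_recenter[of _ m, symmetric])
  have PG: "?P \<sigma> * G \<sigma> = 1\<^sub>m m" if "\<sigma> \<in> ball \<sigma>0 r" for \<sigma>
    using inv[OF that] pencil[of \<sigma>] by simp
  \<comment> \<open>The last factor of \<open>Z\<close>, recentred at \<open>\<sigma>0\<close> so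
    that it is affine in \<open>\<sigma> - \<sigma>0\<close>.\<close>
  let ?N = "affine_mat n (caffine_mat n A0 A \<sigma>0 - cmat Abar) (\<lambda>l. cmat (A l))"
  define F where "F \<sigma> = cmat W * G \<sigma> * (cmat W)\<^sup>T" for \<sigma>
  have WG: "cmat W * G \<sigma> \<in> carrier_mat n m" for \<sigma> using W G[of \<sigma>] by (rule mult_carrier_mat)
  have WT: "(cmat W)\<^sup>T \<in> carrier_mat m n" using W by simp
  have F: "F \<sigma> \<in> carrier_mat n n" for \<sigma>
    unfolding F_def by (rule mult_carrier_mat[OF WG WT])
  have Z: "?Z \<sigma> = F \<sigma> * ?N (\<sigma> - \<sigma>0)" if "\<sigma> \<in> ball \<sigma>0 r" for \<sigma>
    unfolding Z_mat_def F_def mat_inverse_eqI(2)[OF P G PG[OF that]]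
    using affine_mat_recenter[of "cmat Abar" n "cmat A0" "\<lambda>l. cmat (A l)" \<sigma> \<sigma>0] Abar by simp
  have "analytic_near \<sigma>0 r (\<lambda>\<sigma>. F \<sigma> $$ (i, j))" if "i < n" "j < n" for i j
    unfolding F_def
    by (rule analytic_near_mult_const_mat[OF WT WG analytic_near_const_mat_mult[OF W G an]]) (use that in auto)
  then have "analytic_near \<sigma>0 r (\<lambda>\<sigma>. (F \<sigma> * ?N (\<sigma> - \<sigma>0)) $$ (i, j))" if "i < n" "j < n" for i j
    by (rule analytic_near_mult_affine_mat[OF F]) (use that in auto)
  \<comment> \<open>\<open>G\<close> is known to be the inverse only inside the ball, so
    \<open>Z\<close> is replaced by the product there.\<close>
  then have Z_an: "analytic_near \<sigma>0 r (\<lambda>\<sigma>. ?Z \<sigma> $$ (i, j))" if "i < n" "j < n" for i j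
    using that by (subst analytic_near_cong[where g = "\<lambda>\<sigma>. (F \<sigma> * ?N (\<sigma> - \<sigma>0)) $$ (i, j)"]) (simp_all add: Z)
  obtain C where C: "\<And>k. C k \<in> carrier_mat n n"
    "\<And>\<sigma>. \<sigma> \<in> ball \<sigma>0 r \<Longrightarrow> power_series_at n ?Z C \<sigma>0 \<sigma>"
    using power_series_at_if_entries_analytic[of n \<sigma>0 r ?Z, OF Z_an] by metis
  have "invertible_mat (?P \<sigma>) \<and> ?Z \<sigma> \<in> carrier_mat n n \<and> power_series_at n ?Z C \<sigma>0 \<sigma>"
    if "\<sigma> \<in> ball \<sigma>0 r" for \<sigma>
    using mat_inverse_eqI(1)[OF P G PG[OF that]] C(2)[OF that]
      mult_carrier_mat[OF F affine_mat_carrier] Z[OF that] by simp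
  with r C(1) show ?thesis by blast
qed

end
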